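(* Let $\mathcal{L}\subset\mathbb{R}^d$ be a $d$-dimensional lattice whose fundamental domain $\mathcal{D}$ satisfies $m_d(\mathcal{D})=1$, and let $\{\xi_n\}_{n\in\mathcal{L}}$ be independent and identically distributed random vectors in $\mathbb{R}^d$, all with common probability law $\xi$, defined on a probability space $(\Omega,\mathcal{F},\mathbb{P})$. Assume that $\mathbb{E}\left[|\xi|^{d+\varepsilon}\right]<\infty$ for some $\varepsilon>0$. Let $W:=\{n+\xi_n\mid n\in\mathcal{L}\}$, let $$M_R(\lambda):=\frac{1}{m_d(B_R)}\sum_{w\in W\cap B_R}\overline{e(\langle w,\lambda\rangle)},$$ and let $T:\Omega\times\mathbb{R}^d\to\mathbb{C}$ be the map given by $$T(\omega,\lambda):=\limsup_{R\to\infty}M_R(\lambda).$$ If $\varphi_\xi(\lambda)\neq 0$ for all $\lambda\in\mathbb{R}^d$, then $$\mathbb{P}\left(\left\{\lambda\in\mathbb{R}^d \mid T(\omega,\lambda)\neq 0\right\}=\mathcal{L}^\ast\right)=1 .$$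
   Context: $m_d$ is Lebesgue measure on $\mathbb{R}^d$, $|\cdot|$ and $\langle\cdot,\cdot\rangle$ are the Euclidean norm and inner product, $B_R:=\{x\in\mathbb{R}^d : |x|\le R\}$, and $e(t):=\exp(2\pi i t)$. The dual lattice is $\mathcal{L}^\ast:=\{m\in\mathbb{R}^d : \langle n,m\rangle\in\mathbb{Z}\text{ for all } n\in\mathcal{L}\}$. The characteristic function of $\xi$ is $\varphi_\xi(\lambda):=\mathbb{E}\left[\overline{e(\langle\xi,\lambda\rangle)}\right]$. $M_R(\lambda)$ depends on the realization $\omega\in\Omega$ through the random set $W$.
   Formalization: W is counted with multiplicity: coinciding points n+ξ_n are not merged in the sum M_R. With merging the claim fails for some laws with atoms; for atomless laws both readings agree almost surely. The complex limsup is taken separately in real and imaginary parts. *)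

theory Defs
  imports "HOL-Probability.Probability"
begin

definition full_lattice :: "(real ^ 'd) set \<Rightarrow> bool" where
  "full_lattice L \<longleftrightarrow>
     (\<exists>B. independent B \<and> span B = UNIV \<and>
          L = {\<Sum>b\<in>B. of_int (k b) *\<^sub>R b | k. True})"

text \<open>An arbitrary Lebesgue measurable set of representatives modulo \<open>L\<close>; all of them
  have the same measure.\<close>

definition fundamental_domain :: "(real ^ 'd) set \<Rightarrow> (real ^ 'd) set \<Rightarrow> bool" where
  "fundamental_domain L D \<longleftrightarrow>
     D \<in> sets lebesgue \<and> (\<forall>x. \<exists>!n. n \<in> L \<and> x - n \<in> D)"

definition dual_lattice :: "(real ^ 'd) set \<Rightarrow> (real ^ 'd) set" where
  "dual_lattice L = {m. \<forall>n\<in>L. n \<bullet> m \<in> \<int>}"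

definition e_fun :: "real \<Rightarrow> complex" where
  "e_fun t = exp (2 * of_real pi * \<i> * of_real t)"

text \<open>The argument is the law of the random vector.\<close>

definition char_fun :: "(real ^ 'd) measure \<Rightarrow> real ^ 'd \<Rightarrow> complex" where
  "char_fun \<nu> \<theta> = (LINT x|\<nu>. cnj (e_fun (x \<bullet> \<theta>)))"

text \<open>The part in the ball \<open>B\<^sub>R\<close> of the configuration \<open>W = {n + \<xi>\<^sub>n | n \<in> L}\<close>, for a fixed
  outcome \<open>\<omega>\<close>. Points are counted with multiplicity: coinciding \<open>n + \<xi>\<^sub>n\<close>, which occur
  when the law has atoms, are not merged. If infinitely many points fall into the ball,
  \<^const>\<open>mset_set\<close> yields the empty multiset; under the moment assumption of the theorem
  this happens only on a null set.\<close>

definition points_in_ball ::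
    "(real ^ 'd) set \<Rightarrow> (real ^ 'd \<Rightarrow> 'w \<Rightarrow> real ^ 'd) \<Rightarrow> 'w \<Rightarrow> real \<Rightarrow> (real ^ 'd) multiset" where
  "points_in_ball L \<xi> \<omega> R =
     image_mset (\<lambda>n. n + \<xi> n \<omega>) (mset_set {n \<in> L. n + \<xi> n \<omega> \<in> cball 0 R})"

definition exp_mean ::
    "(real ^ 'd) set \<Rightarrow> (real ^ 'd \<Rightarrow> 'w \<Rightarrow> real ^ 'd) \<Rightarrow> 'w \<Rightarrow> real \<Rightarrow> real ^ 'd \<Rightarrow> complex" where
  "exp_mean L \<xi> \<omega> R \<theta> =
     (\<Sum>w\<in>#points_in_ball L \<xi> \<omega> R. cnj (e_fun (w \<bullet> \<theta>)))
       / of_real (measure lebesgue (cball (0 :: real ^ 'd) R))"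

text \<open>The upper limit of a complex-valued function is taken separately in the real and the
  imaginary part. It is the limit whenever that exists; an infinite upper limit of a
  part is replaced by \<open>0\<close>.\<close>

definition complex_limsup :: "(real \<Rightarrow> complex) \<Rightarrow> complex" where
  "complex_limsup f =
     Complex (real_of_ereal (Limsup at_top (\<lambda>R. ereal (Re (f R)))))
             (real_of_ereal (Limsup at_top (\<lambda>R. ereal (Im (f R)))))"

definition T_fun ::
    "(real ^ 'd) set \<Rightarrow> (real ^ 'd \<Rightarrow> 'w \<Rightarrow> real ^ 'd) \<Rightarrow> 'w \<Rightarrow> real ^ 'd \<Rightarrow> complex" where
  "T_fun L \<xi> \<omega> \<theta> = complex_limsup (\<lambda>R. exp_mean L \<xi> \<omega> R \<theta>)"

end

(* By the moment condition and Borel-Cantelli over dyadic shells, for every eta > 0 almost surely only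
   finitely many n have |xi_n| > eta |n|; hence summing over the points of W in B_R or over the
   lattice points n in B_R makes a difference of o(R^d) only. In the latter sum, Hoeffding's
   inequality shows that a deviation of order R^d from the mean has probability exponentially small
   in R^d. A union bound over polynomially many lambda (the points of a rescaled copy of the lattice)
   together with Lipschitz continuity in lambda makes the deviation o(R^d) for all lambda
   simultaneously. The mean is the characteristic function times a lattice character sum, whose
   normalised limit is 1 on the dual lattice and 0 off it, the latter because a translation by a
   lattice vector on which the character is nontrivial changes the sum only near the boundary of the
   ball. *)

theory Submission
  imports Defs "HOL-Real_Asymp.Real_Asymp"
begin

subsection \<open>Lattices and fundamental domains\<close>

text \<open>The obstacle is the uncountable set of frequencies: an almost sure statement for each
  single \<theta> comes with its own null set, and the union of these null sets is out of control.
  So randomness is confined to countably many events, indexed by integer radii, finite grids of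
  frequencies and thresholds \<open>1 / Suc j\<close>; everything after that is a deterministic
  argument for one fixed outcome. This is why a bound exponential in the number of summands is
  wanted: it has to survive a union over a grid that grows polynomially with the radius. No
  uniformity in \<theta> is claimed: the radius from which the grid serves \<theta> depends on
  \<open>norm \<theta>\<close>, only the null set is common. The moment hypothesis works twice: its
  full strength makes large perturbations rare, and the finite first moment it implies gives the
  Lipschitz bound for the characteristic function. Covolume 1 makes the density of lattice points 1,
  so the limit on the dual lattice is exactly the characteristic function.\<close>

lemma full_lattice_zero_mem: "full_lattice L \<Longrightarrow> 0 \<in> L"
  unfolding full_lattice_def by (auto intro!: exI[of _ "\<lambda>_. 0"])

lemma full_lattice_diff_mem:
  assumes "full_lattice L" "x \<in> L" "y \<in> L"
  shows "x - y \<in> L"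
proof -
  obtain B where L: "L = {\<Sum>b\<in>B. of_int (k b) *\<^sub>R b | k. True}"
    using assms(1) unfolding full_lattice_def by blast
  obtain k l where "x = (\<Sum>b\<in>B. of_int (k b) *\<^sub>R b)" "y = (\<Sum>b\<in>B. of_int (l b) *\<^sub>R b)"
    using assms(2,3) L by blast
  then have "x - y = (\<Sum>b\<in>B. of_int (k b - l b) *\<^sub>R b)"
    by (simp add: sum_subtractf scaleR_diff_left)
  then show ?thesis
    unfolding L by (intro CollectI exI[of _ "\<lambda>b. k b - l b"] conjI TrueI)
qed

lemma full_lattice_uminus_mem: "full_lattice L \<Longrightarrow> x \<in> L \<Longrightarrow> - x \<in> L"
  using full_lattice_diff_mem[of L 0 x] full_lattice_zero_mem by auto

lemma full_lattice_add_mem: "full_lattice L \<Longrightarrow> x \<in> L \<Longrightarrow> y \<in> L \<Longrightarrow> x + y \<in> L"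
  using full_lattice_diff_mem[of L x "- y"] full_lattice_uminus_mem by auto

lemma full_lattice_countable:
  assumes "full_lattice L"
  shows "countable L"
proof -
  obtain B where B: "independent B" and L: "L = {\<Sum>b\<in>B. of_int (k b) *\<^sub>R b | k. True}"
    using assms unfolding full_lattice_def by blast
  \<comment> \<open>The coefficient functions \<open>k\<close> live on the whole space and are
    uncountably many; only their restrictions to the finite set \<open>B\<close> matter, hence the
    extensional functions.\<close>
  have "L \<subseteq> (\<lambda>k. \<Sum>b\<in>B. of_int (k b) *\<^sub>R b) ` (\<Pi>\<^sub>E b\<in>B. (UNIV :: int set))"
  proof
    fix x assume "x \<in> L"
    then obtain k where "x = (\<Sum>b\<in>B. of_int (k b) *\<^sub>R b)"
      using L by blast
    then have "x = (\<Sum>b\<in>B. of_int (restrict k B b) *\<^sub>R b)"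
      by simp
    then show "x \<in> (\<lambda>k. \<Sum>b\<in>B. of_int (k b) *\<^sub>R b) ` (\<Pi>\<^sub>E b\<in>B. (UNIV :: int set))"
      by (intro image_eqI[of _ _ "restrict k B"]) auto
  qed
  moreover have "countable (\<Pi>\<^sub>E b\<in>B. (UNIV :: int set))"
    by (rule countable_PiE) (use B finiteI_independent in auto)
  ultimately show ?thesis
    by (meson countable_image countable_subset)
qed

text \<open>The half-open parallelepiped spanned by a basis works, the floors of the coordinates
  giving the lattice point. A given fundamental domain may be unbounded, whereas counting by volume
  needs a bounded one.\<close>

lemma full_lattice_bounded_fundamental_domain:
  assumes "full_lattice L"
  obtains D \<rho> where "fundamental_domain L D" "\<rho> > 0" "D \<subseteq> cball 0 \<rho>"
proof -
  obtain B where B: "independent B" "span B = UNIV"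
    and L: "L = {\<Sum>b\<in>B. of_int (k b) *\<^sub>R b | k. True}"
    using assms unfolding full_lattice_def by blast
  have fin: "finite B"
    using B(1) finiteI_independent by blast
  define c where "c = (\<lambda>b x. representation B x b)"
  have lin: "linear (c b)" for b
    using real_vector.linear_representation[OF B]
    unfolding c_def linear_def real_scaleR_def by (simp add: representation_raw_def)
  have c_sum: "c b (\<Sum>b'\<in>B. r b' *\<^sub>R b') = r b" if "b \<in> B" for b r
  proof -
    have "c b (\<Sum>b'\<in>B. r b' *\<^sub>R b') = (\<Sum>b'\<in>B. r b' * c b b')"
      by (simp add: linear_sum[OF lin] linear_cmul[OF lin])
    also have "\<dots> = (\<Sum>b'\<in>B. if b' = b then r b' else 0)"
      by (rule sum.cong) (simp_all add: c_def representation_basis[OF B(1)])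
    finally show ?thesis
      using that fin by simp
  qed
  have sum_c: "(\<Sum>b\<in>B. c b x *\<^sub>R b) = x" for x
    unfolding c_def by (rule sum_representation_eq) (use B fin in auto)
  define D where "D = {x. \<forall>b\<in>B. 0 \<le> c b x \<and> c b x < 1}"
  have [measurable]: "c b \<in> borel_measurable borel" for b
    by (intro borel_measurable_continuous_onI linear_continuous_on linear_conv_bounded_linear[THEN iffD1] lin)
  have "D = (\<Inter>b\<in>B. {x\<in>space borel. 0 \<le> c b x \<and> c b x < 1}) \<inter> space borel"
    by (auto simp: D_def)
  also have "\<dots> \<in> sets borel"
    using fin by (cases "B = {}") (auto intro!: sets.Int sets.finite_INT)
  finally have meas: "D \<in> sets borel" .
  have "\<exists>!n. n \<in> L \<and> x - n \<in> D" for x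
  proof (rule ex1I)
    let ?n = "\<Sum>b\<in>B. of_int \<lfloor>c b x\<rfloor> *\<^sub>R b"
    show "?n \<in> L \<and> x - ?n \<in> D"
    proof
      show "?n \<in> L"
        unfolding L by (intro CollectI exI[of _ "\<lambda>b. \<lfloor>c b x\<rfloor>"]) simp
      show "x - ?n \<in> D"
        unfolding D_def
      proof (intro CollectI ballI)
        fix b assume "b \<in> B"
        then show "0 \<le> c b (x - ?n) \<and> c b (x - ?n) < 1"
          unfolding linear_diff[OF lin] c_sum[OF \<open>b \<in> B\<close>] by linarith
      qed
    qed
  next
    fix n assume n: "n \<in> L \<and> x - n \<in> D"
    then obtain k where k: "n = (\<Sum>b\<in>B. of_int (k b) *\<^sub>R b)"
      using L by blast
    have "k b = \<lfloor>c b x\<rfloor>" if "b \<in> B" for b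
    proof -
      have "0 \<le> c b (x - n)" "c b (x - n) < 1"
        using n that by (auto simp: D_def)
      then have "of_int (k b) \<le> c b x" "c b x < of_int (k b) + 1"
        unfolding linear_diff[OF lin] k c_sum[OF that] by linarith+
      then show ?thesis
        by linarith
    qed
    then show "n = (\<Sum>b\<in>B. of_int \<lfloor>c b x\<rfloor> *\<^sub>R b)"
      by (simp add: k)
  qed
  then have "fundamental_domain L D"
    using meas by (auto simp: fundamental_domain_def)
  moreover have "D \<subseteq> cball 0 (1 + (\<Sum>b\<in>B. norm b))"
  proof
    fix x assume "x \<in> D"
    then have "norm (c b x *\<^sub>R b) \<le> norm b" if "b \<in> B" for b
      using that by (auto simp: D_def intro!: mult_left_le_one_le)
    then have "norm x \<le> (\<Sum>b\<in>B. norm b)"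
      using norm_sum[of "\<lambda>b. c b x *\<^sub>R b" B] unfolding sum_c
      by (rule order_trans[OF _ sum_mono, rotated])
    then show "x \<in> cball 0 (1 + (\<Sum>b\<in>B. norm b))"
      by simp
  qed
  moreover have "0 < 1 + (\<Sum>b\<in>B. norm b)"
    by (simp add: add_pos_nonneg sum_nonneg)
  ultimately show thesis
    using that by blast
qed

lemma fundamental_domain_translates_disjoint:
  assumes "fundamental_domain L D"
  shows "disjoint_family_on (\<lambda>n. (+) n ` D) L"
  unfolding disjoint_family_on_def
proof (intro ballI impI equals0I)
  fix m n x assume *: "m \<in> L" "n \<in> L" "m \<noteq> n" "x \<in> (+) m ` D \<inter> (+) n ` D"
  then have "x - m \<in> D" "x - n \<in> D"
    by (metis IntE add_diff_cancel_left' imageE)+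
  with * assms show False
    unfolding fundamental_domain_def by blast
qed

lemma fundamental_domain_translates_cover:
  assumes "fundamental_domain L D"
  shows "(\<Union>n\<in>L. (+) n ` D) = UNIV"
proof (intro equalityI subsetI)
  fix x :: "real ^ 'a"
  obtain n where "n \<in> L" "x - n \<in> D"
    using assms unfolding fundamental_domain_def by blast
  then show "x \<in> (\<Union>n\<in>L. (+) n ` D)"
    by (auto intro!: bexI[of _ n] image_eqI[of _ _ "x - n"])
qed simp

text \<open>Cutting \<open>D\<close> by the translates of \<open>E\<close> and moving the pieces back into \<open>E\<close>.\<close>

lemma fundamental_domains_same_measure:
  assumes L: "full_lattice L" and D: "fundamental_domain L D" and E: "fundamental_domain L E"
  shows "emeasure lebesgue D = emeasure lebesgue E"
proof -
  note [measurable] = lebesgue_sets_translation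
  have [measurable]: "D \<in> sets lebesgue" "E \<in> sets lebesgue"
    using D E by (auto simp: fundamental_domain_def)
  have decomp: "emeasure lebesgue A = (\<integral>\<^sup>+n. emeasure lebesgue (A \<inter> (+) n ` B) \<partial>count_space L)"
    if A: "A \<in> sets lebesgue" and B: "fundamental_domain L B" for A B
  proof -
    have [measurable]: "B \<in> sets lebesgue"
      using B by (auto simp: fundamental_domain_def)
    have "emeasure lebesgue A = emeasure lebesgue (\<Union>n\<in>L. A \<inter> (+) n ` B)"
      using fundamental_domain_translates_cover[OF B] by (metis Int_UN_distrib inf_top_right)
    also have "\<dots> = (\<integral>\<^sup>+n. emeasure lebesgue (A \<inter> (+) n ` B) \<partial>count_space L)"
    proof (rule emeasure_UN_countable)
      show "disjoint_family_on (\<lambda>n. A \<inter> (+) n ` B) L"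
        using fundamental_domain_translates_disjoint[OF B]
        unfolding disjoint_family_on_def by blast
    qed (use A full_lattice_countable[OF L] in auto)
    finally show ?thesis .
  qed
  have shift: "emeasure lebesgue ((+) n ` S) = emeasure lebesgue S" for n :: "real^'a" and S
    using emeasure_lebesgue_affine[of 1 n S] by (simp add: add.commute cong: image_cong_simp)
  have "emeasure lebesgue D = (\<integral>\<^sup>+n. emeasure lebesgue (D \<inter> (+) n ` E) \<partial>count_space L)"
    by (rule decomp) (use E in auto)
  also have "\<dots> = (\<integral>\<^sup>+n. emeasure lebesgue (E \<inter> (+) (- n) ` D) \<partial>count_space L)"
  proof (rule nn_integral_cong)
    fix n
    have "(+) (- n) ` (D \<inter> (+) n ` E) = E \<inter> (+) (- n) ` D"
      by (simp add: image_Int image_image Int_commute)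
    then show "emeasure lebesgue (D \<inter> (+) n ` E) = emeasure lebesgue (E \<inter> (+) (- n) ` D)"
      by (metis shift)
  qed
  also have "\<dots> = (\<integral>\<^sup>+n. emeasure lebesgue (E \<inter> (+) n ` D) \<partial>count_space L)"
  proof (rule nn_integral_bij_count_space)
    show "bij_betw uminus L L"
      by (rule bij_betw_byWitness[where f' = uminus]) (auto simp: full_lattice_uminus_mem[OF L])
  qed
  also have "\<dots> = emeasure lebesgue E"
    by (rule decomp[symmetric]) (use D in auto)
  finally show ?thesis .
qed

lemma measure_lebesgue_cball:
  "R \<ge> 0 \<Longrightarrow> measure lebesgue (cball (0 :: real ^ 'd) R) = unit_ball_vol CARD('d) * R ^ CARD('d)"
  by (simp add: content_cball)

text \<open>Volume comparison: translates of a bounded domain \<open>E\<close> by the lattice points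
  of a ball of radius \<open>R\<close> are disjoint, have measure 1, stay inside radius
  \<open>R + \<rho>\<close> and cover radius \<open>R - \<rho>\<close>.\<close>

lemma lattice_count_bounds:
  fixes L D :: "(real ^ 'd) set"
  assumes L: "full_lattice L" and D: "fundamental_domain L D" "measure lebesgue D = 1"
  obtains \<rho> where "\<rho> > 0"
    and "\<And>x. \<exists>n\<in>L. norm (x - n) \<le> \<rho>"
    and "\<And>R. finite (L \<inter> cball 0 R)"
    and "\<And>R. R \<ge> 0 \<Longrightarrow> card (L \<inter> cball 0 R) \<le> unit_ball_vol CARD('d) * (R + \<rho>) ^ CARD('d)"
    and "\<And>R. R \<ge> \<rho> \<Longrightarrow> unit_ball_vol CARD('d) * (R - \<rho>) ^ CARD('d) \<le> card (L \<inter> cball 0 R)"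
proof -
  obtain E \<rho> where E: "fundamental_domain L E" "\<rho> > 0" "E \<subseteq> cball 0 \<rho>"
    using full_lattice_bounded_fundamental_domain[OF L] .
  have E_sets: "E \<in> sets lebesgue"
    using E by (auto simp: fundamental_domain_def)
  \<comment> \<open>\<open>measure\<close> is 0 on sets of infinite measure, so the value 1 for
    \<open>D\<close> also says that \<open>D\<close> has finite measure; it is then transferred to
    \<open>E\<close>.\<close>
  have em: "emeasure lebesgue E = 1"
  proof -
    have "emeasure lebesgue D \<noteq> \<infinity>"
      using D(2) by (auto simp: measure_def)
    then have "emeasure lebesgue D = 1"
      using D(2) by (simp add: emeasure_eq_ennreal_measure)
    then show ?thesis
      using fundamental_domains_same_measure[OF L D(1) E(1)] by simp
  qed
  have E_fm: "E \<in> lmeasurable"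
    using E_sets em by (intro fmeasurableI) auto
  have meas_UN: "(\<Union>n\<in>F. (+) n ` E) \<in> lmeasurable \<and> measure lebesgue (\<Union>n\<in>F. (+) n ` E) = card F"
    if F: "finite F" "F \<subseteq> L" for F
  proof
    show "(\<Union>n\<in>F. (+) n ` E) \<in> lmeasurable"
      using F E_fm by (intro fmeasurable.finite_UN measurable_translation)
    have "measure lebesgue (\<Union>n\<in>F. (+) n ` E) = (\<Sum>n\<in>F. measure lebesgue ((+) n ` E))"
    proof (rule measure_finite_Union)
      show "disjoint_family_on (\<lambda>n. (+) n ` E) F"
        using fundamental_domain_translates_disjoint[OF E(1)] F(2)
        by (rule disjoint_family_on_mono[rotated])
      show "emeasure lebesgue ((+) n ` E) \<noteq> \<infinity>" for n
        using measurable_translation[OF E_fm, of n] by (auto simp: fmeasurable_def)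
    qed (use F E_sets in \<open>auto intro: lebesgue_sets_translation\<close>)
    also have "\<dots> = card F"
      using em by (simp add: measure_translation measure_eq_emeasure_eq_ennreal[of 1])
    finally show "measure lebesgue (\<Union>n\<in>F. (+) n ` E) = card F" .
  qed
  \<comment> \<open>Stated for finite subsets because the finiteness of the lattice ball is not
    known yet; it follows from this bound on the cardinalities.\<close>
  have upper: "card F \<le> unit_ball_vol CARD('d) * (R + \<rho>) ^ CARD('d)"
    if F: "finite F" "F \<subseteq> L \<inter> cball 0 R" and R: "R \<ge> 0" for F R
  proof -
    have "(\<Union>n\<in>F. (+) n ` E) \<subseteq> cball 0 (R + \<rho>)"
    proof clarify
      fix n x assume "n \<in> F" "x \<in> E"
      then have "norm n \<le> R" "norm x \<le> \<rho>"
        using F E(3) by auto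
      then show "n + x \<in> cball 0 (R + \<rho>)"
        using norm_triangle_ineq[of n x] by simp
    qed
    then have "measure lebesgue (\<Union>n\<in>F. (+) n ` E) \<le> measure lebesgue (cball 0 (R + \<rho>) :: (real ^ 'd) set)"
      using meas_UN[of F] F by (intro measure_mono_fmeasurable) auto
    then show ?thesis
      using meas_UN[of F] F R E(2) measure_lebesgue_cball[of "R + \<rho>", where 'd = 'd] by auto
  qed
  have fin: "finite (L \<inter> cball 0 R)" for R
  proof (cases "R \<ge> 0")
    case True
    have "card F \<le> nat \<lfloor>unit_ball_vol CARD('d) * (R + \<rho>) ^ CARD('d)\<rfloor>"
      if "F \<subseteq> L \<inter> cball 0 R" "finite F" for F
      using upper[OF that(2,1) True] by linarith
    then show ?thesis
      using finite_if_finite_subsets_card_bdd by blast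
  qed (auto simp: cball_empty)
  have cover: "\<exists>n\<in>L. norm (x - n) \<le> \<rho>" for x
    using E unfolding fundamental_domain_def by (metis in_mono mem_cball_0)
  have lower: "unit_ball_vol CARD('d) * (R - \<rho>) ^ CARD('d) \<le> card (L \<inter> cball 0 R)" if "R \<ge> \<rho>" for R
  proof -
    have "cball 0 (R - \<rho>) \<subseteq> (\<Union>n\<in>L \<inter> cball 0 R. (+) n ` E)"
    proof
      fix x assume x: "x \<in> cball (0 :: real ^ 'd) (R - \<rho>)"
      obtain n where n: "n \<in> L" "x - n \<in> E"
        using E(1) unfolding fundamental_domain_def by blast
      have "norm n \<le> R"
        using n x E(3) norm_triangle_ineq4[of x "x - n"] by auto
      then show "x \<in> (\<Union>n\<in>L \<inter> cball 0 R. (+) n ` E)"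
        using n by (auto intro!: bexI[of _ n] image_eqI[of _ _ "x - n"])
    qed
    then have "measure lebesgue (cball 0 (R - \<rho>) :: (real ^ 'd) set)
        \<le> measure lebesgue (\<Union>n\<in>L \<inter> cball 0 R. (+) n ` E)"
      using meas_UN[of "L \<inter> cball 0 R"] fin by (intro measure_mono_fmeasurable) auto
    then show ?thesis
      using meas_UN[of "L \<inter> cball 0 R"] fin that measure_lebesgue_cball[of "R - \<rho>", where 'd = 'd]
      by auto
  qed
  show thesis
    using that[OF E(2) cover fin] upper[OF fin] lower by blast
qed

subsection \<open>Additive characters\<close>

lemma e_fun_add: "e_fun (s + t) = e_fun s * e_fun t"
  by (simp add: e_fun_def distrib_left exp_add)

lemma norm_e_fun [simp]: "norm (e_fun t) = 1"
  by (simp add: e_fun_def)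

lemma e_fun_eq_1_iff: "e_fun t = 1 \<longleftrightarrow> t \<in> \<int>"
  by (auto simp: e_fun_def exp_eq_1 elim!: Ints_cases)

lemma norm_e_fun_diff_le: "norm (e_fun s - e_fun t) \<le> 2 * pi * \<bar>s - t\<bar>"
proof -
  have "e_fun s - e_fun t = e_fun t * (e_fun (s - t) - 1)"
    using e_fun_add[of "s - t" t] by (simp add: algebra_simps)
  then have "norm (e_fun s - e_fun t) = norm (e_fun (s - t) - 1)"
    by (simp add: norm_mult)
  also have "e_fun (s - t) = exp (\<i> * of_real (2 * pi * (s - t)))"
    by (simp add: e_fun_def mult_ac)
  also have "norm (\<dots> - 1) = 2 * \<bar>sin (pi * (s - t))\<bar>"
    by (simp only: dist_exp_i_1) (simp add: mult.assoc)
  also have "\<dots> \<le> 2 * pi * \<bar>s - t\<bar>"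
    using abs_sin_x_le_abs_x[of "pi * (s - t)"] by (simp add: abs_mult)
  finally show ?thesis .
qed

text \<open>Each sum differs from the one over the common part \<open>C\<close> by at most
  \<open>K\<close> per point of \<open>U - C\<close>. Two index sets caught between \<open>C\<close>
  and \<open>U\<close> are thus compared by counting alone; this serves for translated balls,
  rounded radii and perturbed points.\<close>

lemma norm_sum_diff_le_card:
  fixes f :: "'a \<Rightarrow> complex"
  assumes "finite U" "C \<subseteq> A" "C \<subseteq> B" "A \<subseteq> U" "B \<subseteq> U" "\<And>x. x \<in> U \<Longrightarrow> norm (f x) \<le> K"
  shows "norm (sum f A - sum f B) \<le> 2 * K * (real (card U) - real (card C))"
proof -
  have *: "norm (sum f X - sum f C) \<le> K * (real (card U) - real (card C))"
    if "C \<subseteq> X" "X \<subseteq> U" for X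
  proof -
    have "sum f X - sum f C = sum f (X - C)"
      using that assms(1) finite_subset sum_diff[of X C f] by metis
    also have "norm \<dots> \<le> (\<Sum>x\<in>X - C. K)"
      by (rule sum_norm_le) (use assms that in auto)
    also have "\<dots> \<le> (\<Sum>x\<in>U - C. K)"
      using that assms(1) norm_ge_zero[THEN order_trans, OF assms(6)] by (intro sum_mono2) auto
    also have "\<dots> = K * (real (card U) - real (card C))"
      using that assms(1) by (subst sum_constant, subst card_Diff_subset)
        (auto intro: finite_subset simp: card_mono of_nat_diff mult.commute)
    finally show ?thesis .
  qed
  have "norm (sum f A - sum f B) \<le> norm (sum f A - sum f C) + norm (sum f B - sum f C)"
    using norm_triangle_ineq4[of "sum f A - sum f C" "sum f B - sum f C"] by simp
  also have "\<dots> \<le> 2 * K * (real (card U) - real (card C))"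
    using *[of A] *[of B] assms by simp
  finally show ?thesis .
qed

subsection \<open>Counting lattice points\<close>

locale unit_lattice =
  fixes L D :: "(real ^ 'd) set"
  assumes full: "full_lattice L"
    and dom: "fundamental_domain L D"
    and unit: "measure lebesgue D = 1"
begin

definition vol :: "real \<Rightarrow> real" where
  "vol R = measure lebesgue (cball (0 :: real ^ 'd) R)"

definition N :: "real \<Rightarrow> real" where
  "N R = real (card (L \<inter> cball 0 R))"

lemma covering_radius:
  obtains \<rho> where "\<rho> > 0" "\<And>x. \<exists>n\<in>L. norm (x - n) \<le> \<rho>"
  using lattice_count_bounds[OF full dom unit] by metis

lemma finite_ball [simp]: "finite (L \<inter> cball 0 R)"
  using lattice_count_bounds[OF full dom unit] by metis

lemma N_mono: "r \<le> R \<Longrightarrow> N r \<le> N R"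
  unfolding N_def by (auto intro!: card_mono)

lemma N_nonneg [simp]: "N R \<ge> 0"
  by (simp add: N_def)

lemma vol_nonneg [simp]: "vol R \<ge> 0"
  by (simp add: vol_def)

text \<open>A shift \<open>c\<close> of the radius vanishes in the limit, a dilation
  \<open>a\<close> costs the factor \<open>a ^ CARD('d)\<close>. Shifts occur in boundary shells,
  dilations when perturbations proportional to \<open>norm n\<close> are absorbed.\<close>

lemma tendsto_ball_volume_ratio:
  assumes "a > 0"
  shows "((\<lambda>R. unit_ball_vol CARD('d) * (a * R + c) ^ CARD('d) / vol R) \<longlongrightarrow> a ^ CARD('d)) at_top"
proof -
  have "((\<lambda>R. c / R) \<longlongrightarrow> 0) at_top"
    by real_asymp
  then have "((\<lambda>R. (a + c / R) ^ CARD('d)) \<longlongrightarrow> (a + 0) ^ CARD('d)) at_top"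
    by (intro tendsto_intros)
  moreover have "\<forall>\<^sub>F R in at_top. (a + c / R) ^ CARD('d)
      = unit_ball_vol CARD('d) * (a * R + c) ^ CARD('d) / vol R"
    using eventually_gt_at_top[of 0]
  proof eventually_elim
    case (elim R)
    have "unit_ball_vol CARD('d) \<noteq> 0"
      by (metis less_irrefl of_nat_0_le_iff unit_ball_vol_pos)
    moreover have "(a + c / R) = (a * R + c) / R"
      using elim by (simp add: field_simps)
    ultimately show ?case
      using elim by (simp add: vol_def measure_lebesgue_cball power_divide del: measure_completion)
  qed
  ultimately show ?thesis
    by (auto elim: Lim_transform_eventually)
qed

lemma tendsto_N_ratio:
  assumes "a > 0"
  shows "((\<lambda>R. N (a * R + c) / vol R) \<longlongrightarrow> a ^ CARD('d)) at_top"
proof -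
  obtain \<rho> where
    upper: "\<And>R. R \<ge> 0 \<Longrightarrow> N R \<le> unit_ball_vol CARD('d) * (R + \<rho>) ^ CARD('d)" and
    lower: "\<And>R. R \<ge> \<rho> \<Longrightarrow> unit_ball_vol CARD('d) * (R - \<rho>) ^ CARD('d) \<le> N R"
    unfolding N_def using lattice_count_bounds[OF full dom unit] by metis
  show ?thesis
  proof (rule tendsto_sandwich)
    show "((\<lambda>R. unit_ball_vol CARD('d) * (a * R + (c - \<rho>)) ^ CARD('d) / vol R) \<longlongrightarrow> a ^ CARD('d)) at_top"
      "((\<lambda>R. unit_ball_vol CARD('d) * (a * R + (c + \<rho>)) ^ CARD('d) / vol R) \<longlongrightarrow> a ^ CARD('d)) at_top"
      by (rule tendsto_ball_volume_ratio[OF assms])+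
    have "filterlim (\<lambda>R. a * R + c) at_top at_top"
      using assms by real_asymp
    then have "\<forall>\<^sub>F R in at_top. a * R + c \<ge> max 0 \<rho>"
      unfolding filterlim_at_top by blast
    then show "\<forall>\<^sub>F R in at_top. unit_ball_vol CARD('d) * (a * R + (c - \<rho>)) ^ CARD('d) / vol R \<le> N (a * R + c) / vol R"
      "\<forall>\<^sub>F R in at_top. N (a * R + c) / vol R \<le> unit_ball_vol CARD('d) * (a * R + (c + \<rho>)) ^ CARD('d) / vol R"
      using lower[of "a * _ + c"] upper[of "a * _ + c"]
      by (auto elim!: eventually_mono intro!: divide_right_mono simp: algebra_simps)
  qed
qed

lemma tendsto_N_shell: "((\<lambda>R. (N (R + b) - N (R - b)) / vol R) \<longlongrightarrow> 0) at_top"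
  using tendsto_diff[OF tendsto_N_ratio[of 1 b] tendsto_N_ratio[of 1 "- b"]]
  by (simp add: diff_divide_distrib)

lemma tendsto_character_sum:
  "((\<lambda>R. (\<Sum>n\<in>L \<inter> cball 0 R. cnj (e_fun (n \<bullet> \<theta>))) / vol R)
     \<longlongrightarrow> (if \<theta> \<in> dual_lattice L then 1 else 0)) at_top"
proof (cases "\<theta> \<in> dual_lattice L")
  case True
  then have "e_fun (n \<bullet> \<theta>) = 1" if "n \<in> L" for n
    using that by (auto simp: dual_lattice_def e_fun_eq_1_iff)
  then have "(\<Sum>n\<in>L \<inter> cball 0 R. cnj (e_fun (n \<bullet> \<theta>))) = of_real (N R)" for R
    by (simp add: N_def)
  then show ?thesis
    using tendsto_of_real[OF tendsto_N_ratio[of 1 0], where 'a = complex] True by simp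
next
  case False
  then obtain m where m: "m \<in> L" "m \<bullet> \<theta> \<notin> \<int>"
    by (auto simp: dual_lattice_def)
  define f where "f = (\<lambda>n. cnj (e_fun (n \<bullet> \<theta>)))"
  define z where "z = f m"
  have z: "z \<noteq> 1"
    using m by (simp add: z_def f_def e_fun_eq_1_iff complex_cnj_one_iff)
  have bound: "norm (sum f (L \<inter> cball 0 R) / vol R)
      \<le> 2 / norm (z - 1) * ((N (R + norm m) - N (R - norm m)) / vol R)" if "R > 0" for R
  proof -
    \<comment> \<open>Multiplying by \<open>z = f m\<close> translates the index by
      \<open>m\<close>, so \<open>z - 1\<close> times the sum is a difference of sums over two balls
      that share the ball of radius \<open>R - norm m\<close>.\<close>
    have "z * sum f (L \<inter> cball 0 R) = (\<Sum>n\<in>L \<inter> cball 0 R. f (m + n))"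
      by (simp add: sum_distrib_left z_def f_def inner_add_left e_fun_add)
    also have "\<dots> = sum f ((+) m ` (L \<inter> cball 0 R))"
      by (subst sum.reindex) auto
    finally have "norm ((z - 1) * sum f (L \<inter> cball 0 R))
        = norm (sum f ((+) m ` (L \<inter> cball 0 R)) - sum f (L \<inter> cball 0 R))"
      by (simp add: algebra_simps)
    also have "\<dots> \<le> 2 * 1 * (real (card (L \<inter> cball 0 (R + norm m))) - real (card (L \<inter> cball 0 (R - norm m))))"
    proof (rule norm_sum_diff_le_card)
      show "L \<inter> cball 0 (R - norm m) \<subseteq> (+) m ` (L \<inter> cball 0 R)"
      proof
        fix x assume x: "x \<in> L \<inter> cball 0 (R - norm m)"
        then have "x - m \<in> L \<inter> cball 0 R"
          using full_lattice_diff_mem[OF full _ m(1)] norm_triangle_ineq4[of x m] by auto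
        then show "x \<in> (+) m ` (L \<inter> cball 0 R)"
          by (rule rev_image_eqI) simp
      qed
      show "(+) m ` (L \<inter> cball 0 R) \<subseteq> L \<inter> cball 0 (R + norm m)"
      proof clarify
        fix x assume "x \<in> L" "x \<in> cball 0 R"
        then show "m + x \<in> L \<inter> cball 0 (R + norm m)"
          using full_lattice_add_mem[OF full m(1)] norm_triangle_ineq[of m x] by auto
      qed
      show "L \<inter> cball 0 (R - norm m) \<subseteq> L \<inter> cball 0 R" "L \<inter> cball 0 R \<subseteq> L \<inter> cball 0 (R + norm m)"
        by (intro Int_mono subset_cball; simp)+
    qed (auto simp: f_def)
    finally have "norm (z - 1) * norm (sum f (L \<inter> cball 0 R)) \<le> 2 * (N (R + norm m) - N (R - norm m))"
      by (simp add: N_def norm_mult)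
    then have "norm (sum f (L \<inter> cball 0 R)) \<le> 2 / norm (z - 1) * (N (R + norm m) - N (R - norm m))"
      using z by (simp add: field_simps)
    then have "norm (sum f (L \<inter> cball 0 R)) / vol R
        \<le> 2 / norm (z - 1) * (N (R + norm m) - N (R - norm m)) / vol R"
      by (rule divide_right_mono) simp
    then show ?thesis
      by (simp add: norm_divide)
  qed
  have "((\<lambda>R. sum f (L \<inter> cball 0 R) / vol R) \<longlongrightarrow> 0) at_top"
  proof (rule Lim_null_comparison)
    show "\<forall>\<^sub>F R in at_top. norm (sum f (L \<inter> cball 0 R) / vol R)
      \<le> 2 / norm (z - 1) * ((N (R + norm m) - N (R - norm m)) / vol R)"
      using eventually_gt_at_top[of 0] by eventually_elim (rule bound)
    show "((\<lambda>R. 2 / norm (z - 1) * ((N (R + norm m) - N (R - norm m)) / vol R)) \<longlongrightarrow> 0) at_top"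
      using tendsto_mult_right_zero[OF tendsto_N_shell] by blast
  qed
  then show ?thesis
    using False by (simp add: f_def)
qed

text \<open>The lower bound is linear only, far below the true growth in higher dimension, but it
  already lets \<open>exp (- N R)\<close> beat every polynomial.\<close>

lemma N_bounds:
  obtains C c :: real where "C > 0" "c > 0"
    and "\<And>R. R \<ge> 1 \<Longrightarrow> N R \<le> C * R ^ CARD('d)"
    and "\<forall>\<^sub>F R in at_top. c * R \<le> N R"
proof -
  obtain \<rho> where "\<rho> > 0" and
    upper: "\<And>R. R \<ge> 0 \<Longrightarrow> N R \<le> unit_ball_vol CARD('d) * (R + \<rho>) ^ CARD('d)" and
    lower: "\<And>R. R \<ge> \<rho> \<Longrightarrow> unit_ball_vol CARD('d) * (R - \<rho>) ^ CARD('d) \<le> N R"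
    unfolding N_def using lattice_count_bounds[OF full dom unit] by metis
  define \<kappa> where "\<kappa> = unit_ball_vol CARD('d)"
  have \<kappa>: "\<kappa> > 0"
    by (simp add: \<kappa>_def)
  have "N R \<le> \<kappa> * (1 + \<rho>) ^ CARD('d) * R ^ CARD('d)" if "R \<ge> 1" for R
  proof -
    have "R + \<rho> \<le> (1 + \<rho>) * R"
      using that \<open>\<rho> > 0\<close> mult_left_mono[of 1 R \<rho>] by (simp add: algebra_simps)
    then have "(R + \<rho>) ^ CARD('d) \<le> ((1 + \<rho>) * R) ^ CARD('d)"
      using that \<open>\<rho> > 0\<close> by (intro power_mono) auto
    then have "\<kappa> * (R + \<rho>) ^ CARD('d) \<le> \<kappa> * ((1 + \<rho>) * R) ^ CARD('d)"
      using \<kappa> by (intro mult_left_mono) auto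
    then have "N R \<le> \<kappa> * ((1 + \<rho>) * R) ^ CARD('d)"
      using upper[of R] that unfolding \<kappa>_def by linarith
    then show ?thesis
      by (simp add: power_mult_distrib mult.assoc)
  qed
  moreover have "\<forall>\<^sub>F R in at_top. \<kappa> / 2 * R \<le> N R"
    \<comment> \<open>From here on \<open>R - \<rho>\<close> is at least 1, so it is below its own
      power, and at least \<open>R / 2\<close>.\<close>
    using eventually_ge_at_top[of "2 * \<rho> + 1"]
  proof eventually_elim
    case (elim R)
    show ?case
    proof (cases "R \<ge> \<rho> + 1")
      case True
      then have "R - \<rho> \<le> (R - \<rho>) ^ CARD('d)"
        by (intro self_le_power) auto
      then have "\<kappa> * (R / 2) \<le> \<kappa> * (R - \<rho>) ^ CARD('d)"
        using elim \<kappa> by (intro mult_left_mono) auto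
      also have "\<dots> \<le> N R"
        unfolding \<kappa>_def using True by (intro lower) simp
      finally show ?thesis
        by simp
    qed (use elim \<open>\<rho> > 0\<close> in linarith)
  qed
  ultimately show thesis
    using that[of "\<kappa> * (1 + \<rho>) ^ CARD('d)" "\<kappa> / 2"] \<kappa> \<open>\<rho> > 0\<close> by auto
qed

end

lemma summable_power_times_exp_minus:
  fixes a :: real
  assumes "a > 0"
  shows "summable (\<lambda>k. real k ^ m * exp (- (a * real k)))"
proof (rule summable_comparison_test_bigo)
  show "summable (\<lambda>k. norm (inverse (real k ^ 2)))"
    using inverse_power_summable[of 2, where 'a = real] by (simp add: power_inverse)
  show "(\<lambda>k. real k ^ m * exp (- (a * real k))) \<in> O(\<lambda>k. inverse (real k ^ 2))"
    using assms by real_asymp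
qed

subsection \<open>Random perturbations\<close>

locale perturbed_lattice = unit_lattice L D + prob_space M
  for L D :: "(real ^ 'd) set" and M :: "'w measure" +
  fixes \<xi> :: "real ^ 'd \<Rightarrow> 'w \<Rightarrow> real ^ 'd"
    and \<nu> :: "(real ^ 'd) measure"
    and \<epsilon> :: real
  assumes indep: "indep_vars (\<lambda>_. borel) \<xi> L"
    and ident: "\<And>n. n \<in> L \<Longrightarrow> distr M borel (\<xi> n) = \<nu>"
    and eps: "\<epsilon> > 0"
    and moment: "integrable \<nu> (\<lambda>x. norm x powr (real CARD('d) + \<epsilon>))"
begin

lemma xi_measurable [measurable]: "n \<in> L \<Longrightarrow> \<xi> n \<in> borel_measurable M"
  using indep unfolding indep_vars_def by blast

lemma nu_props: "prob_space \<nu>" "sets \<nu> = sets borel" "space \<nu> = UNIV"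
proof -
  have 0: "0 \<in> L" "\<nu> = distr M borel (\<xi> 0)"
    using full_lattice_zero_mem[OF full] ident by auto
  show "sets \<nu> = sets borel" "space \<nu> = UNIV"
    unfolding 0(2) by auto
  show "prob_space \<nu>"
    unfolding 0(2) using 0(1) by (intro prob_space_distr) simp
qed

sublocale nu: prob_space \<nu>
  by (rule nu_props)

lemma measurable_nu [simp, measurable_cong]: "sets \<nu> = sets borel"
  by (rule nu_props)

lemma space_nu [simp]: "space \<nu> = UNIV"
  by (rule nu_props)

text \<open>The exponent is at least 1, so the norm is dominated by 1 plus its power. The integral
  is, up to \<open>2 * pi\<close>, the Lipschitz constant of \<open>char_fun \<nu>\<close>.\<close>

lemma integrable_norm_nu: "integrable \<nu> norm"
proof (rule Bochner_Integration.integrable_bound)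
  show "integrable \<nu> (\<lambda>x. 1 + norm x powr (real CARD('d) + \<epsilon>))"
    using moment by simp
  have "norm x \<le> 1 + norm x powr (real CARD('d) + \<epsilon>)" for x :: "real ^ 'd"
  proof (cases "norm x \<le> 1")
    case False
    have "1 \<le> real CARD('d) + \<epsilon>"
      using zero_less_card_finite[where 'a = 'd] eps by linarith
    then have "norm x powr 1 \<le> norm x powr (real CARD('d) + \<epsilon>)"
      by (rule powr_mono) (use False in simp)
    then show ?thesis
      using False by simp
  qed (simp add: add_increasing2)
  then show "AE x in \<nu>. norm (norm x) \<le> norm (1 + norm x powr (real CARD('d) + \<epsilon>))"
    by simp
qed simp

lemma character_measurable [measurable]:
  "(\<lambda>x. cnj (e_fun (x \<bullet> \<theta>))) \<in> borel_measurable borel" for \<theta> :: "real ^ 'd"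
  unfolding e_fun_def by (intro borel_measurable_continuous_onI continuous_intros)

lemma integrable_character: "integrable \<nu> (\<lambda>x. cnj (e_fun (x \<bullet> \<theta>)))"
  by (rule nu.integrable_const_bound[of _ 1]) auto

lemma norm_char_fun_le: "norm (char_fun \<nu> \<theta>) \<le> 1"
proof -
  have "norm (char_fun \<nu> \<theta>) \<le> (LINT x|\<nu>. norm (cnj (e_fun (x \<bullet> \<theta>))))"
    unfolding char_fun_def by (rule integral_norm_bound)
  then show ?thesis
    by (simp add: nu.prob_space[simplified])
qed

lemma norm_character_diff_le:
  "norm (cnj (e_fun (x \<bullet> \<theta>)) - cnj (e_fun (x \<bullet> \<theta>'))) \<le> 2 * pi * norm x * norm (\<theta> - \<theta>')"
proof -
  have "norm (cnj (e_fun (x \<bullet> \<theta>)) - cnj (e_fun (x \<bullet> \<theta>'))) = norm (e_fun (x \<bullet> \<theta>) - e_fun (x \<bullet> \<theta>'))"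
    by (metis complex_cnj_diff complex_mod_cnj)
  also have "\<dots> \<le> 2 * pi * \<bar>x \<bullet> (\<theta> - \<theta>')\<bar>"
    using norm_e_fun_diff_le[of "x \<bullet> \<theta>" "x \<bullet> \<theta>'"] by (simp add: inner_diff_right)
  also have "\<dots> \<le> 2 * pi * (norm x * norm (\<theta> - \<theta>'))"
    by (intro mult_left_mono Cauchy_Schwarz_ineq2) auto
  finally show ?thesis
    by (simp add: mult.assoc)
qed

lemma norm_char_fun_diff_le:
  "norm (char_fun \<nu> \<theta> - char_fun \<nu> \<theta>') \<le> 2 * pi * (LINT x|\<nu>. norm x) * norm (\<theta> - \<theta>')"
proof -
  have "char_fun \<nu> \<theta> - char_fun \<nu> \<theta>' = (LINT x|\<nu>. cnj (e_fun (x \<bullet> \<theta>)) - cnj (e_fun (x \<bullet> \<theta>')))"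
    unfolding char_fun_def using integrable_character by (intro Bochner_Integration.integral_diff[symmetric])
  also have "norm \<dots> \<le> (LINT x|\<nu>. norm (cnj (e_fun (x \<bullet> \<theta>)) - cnj (e_fun (x \<bullet> \<theta>'))))"
    by (rule integral_norm_bound)
  also have "\<dots> \<le> (LINT x|\<nu>. 2 * pi * norm x * norm (\<theta> - \<theta>'))"
    using integrable_norm_nu integrable_character
    by (intro integral_mono norm_character_diff_le) auto
  also have "\<dots> = 2 * pi * (LINT x|\<nu>. norm x) * norm (\<theta> - \<theta>')"
    by simp
  finally show ?thesis .
qed

section \<open>Rarity of large perturbations\<close>

lemma prob_norm_xi_gt:
  assumes "n \<in> L" "a > 0"
  shows "prob {\<omega> \<in> space M. norm (\<xi> n \<omega>) > a}
    \<le> (LINT x|\<nu>. norm x powr (real CARD('d) + \<epsilon>)) / a powr (real CARD('d) + \<epsilon>)"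
proof -
  let ?p = "real CARD('d) + \<epsilon>"
  have "prob {\<omega> \<in> space M. norm (\<xi> n \<omega>) > a} = prob (\<xi> n -` {x. norm x > a} \<inter> space M)"
    by (rule arg_cong[where f = prob]) auto
  also have "\<dots> = measure (distr M borel (\<xi> n)) {x. norm x > a}"
    using assms by (intro measure_distr[symmetric]) auto
  also have "\<dots> = measure \<nu> {x. norm x > a}"
    by (simp add: ident assms)
  also have "\<dots> \<le> measure \<nu> {x \<in> space \<nu>. norm x powr ?p \<ge> a powr ?p}"
    using assms eps by (intro nu.finite_measure_mono) (auto intro: powr_mono2)
  also have "\<dots> \<le> (LINT x|\<nu>. norm x powr ?p) / a powr ?p"
    using assms moment by (intro integral_Markov_inequality_measure[where A = "{}"]) auto
  finally show ?thesis .
qed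

text \<open>At scale \<open>2 ^ k\<close> there are O(2^(kd)) lattice points, and Markov's
  inequality gives each a probability O(2^(-k(d + \<epsilon>))). The union bound leaves a geometric
  series in \<open>2 powr (- \<epsilon>)\<close>, and Borel-Cantelli applies.\<close>

lemma AE_finite_large_perturbations:
  assumes "\<eta> > 0"
  shows "AE \<omega> in M. finite {n \<in> L. norm (\<xi> n \<omega>) > \<eta> * norm n}"
proof -
  let ?d = "CARD('d)" and ?p = "real CARD('d) + \<epsilon>"
  define E where "E = (LINT x|\<nu>. norm x powr ?p)"
  have "E \<ge> 0"
    unfolding E_def by (rule Bochner_Integration.integral_nonneg) simp
  obtain C where C: "C > 0" "\<And>R. R \<ge> 1 \<Longrightarrow> N R \<le> C * R ^ ?d"
    using N_bounds by metis
  \<comment> \<open>The whole ball replaces the dyadic shell and the threshold uses the inner radius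
    \<open>2 ^ k\<close>; this enlarges the event but keeps the order of the bound.\<close>
  define A where "A k = (\<Union>n\<in>L \<inter> cball 0 (2 ^ Suc k). {\<omega> \<in> space M. norm (\<xi> n \<omega>) > \<eta> * 2 ^ k})" for k
  have A_sets: "A k \<in> events" for k
    unfolding A_def by (intro sets.finite_UN) auto
  have bound: "prob (A k) \<le> (C * 2 ^ ?d * E / \<eta> powr ?p) * (2 powr (- \<epsilon>)) ^ k" for k
  proof -
    have "prob (A k) \<le> (\<Sum>n\<in>L \<inter> cball 0 (2 ^ Suc k). prob {\<omega> \<in> space M. norm (\<xi> n \<omega>) > \<eta> * 2 ^ k})"
      unfolding A_def by (intro finite_measure_subadditive_finite) auto
    also have "\<dots> \<le> (\<Sum>n\<in>L \<inter> cball 0 (2 ^ Suc k). E / (\<eta> * 2 ^ k) powr ?p)"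
      unfolding E_def using assms by (intro sum_mono prob_norm_xi_gt) auto
    also have "\<dots> = N (2 ^ Suc k) * (E / (\<eta> * 2 ^ k) powr ?p)"
      by (simp add: N_def)
    also have "\<dots> \<le> (C * (2 ^ Suc k) ^ ?d) * (E / (\<eta> * 2 ^ k) powr ?p)"
      using \<open>E \<ge> 0\<close> by (intro mult_right_mono C one_le_power) auto
    also have "(\<eta> * 2 ^ k) powr ?p = \<eta> powr ?p * ((2 ^ k) ^ ?d * (2 powr \<epsilon>) ^ k)"
    proof -
      have "(2 ^ k :: real) powr \<epsilon> = (2 powr \<epsilon>) ^ k"
        by (simp add: powr_powr mult.commute flip: powr_realpow)
      then show ?thesis
        using assms by (simp add: powr_mult powr_add powr_realpow)
    qed
    also have "(C * (2 ^ Suc k) ^ ?d) * (E / (\<eta> powr ?p * ((2 ^ k) ^ ?d * (2 powr \<epsilon>) ^ k)))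
        = (C * 2 ^ ?d * E / \<eta> powr ?p) * (2 powr (- \<epsilon>)) ^ k"
      using assms by (simp add: powr_minus field_simps power_mult_distrib)
    finally show ?thesis .
  qed
  have "2 powr (- \<epsilon>) < 1"
    using powr_less_mono[of "- \<epsilon>" 0 2] eps by (simp only: powr_zero_eq_one) simp
  then have "summable (\<lambda>k. (C * 2 ^ ?d * E / \<eta> powr ?p) * (2 powr (- \<epsilon>)) ^ k)"
    by (intro summable_mult summable_geometric) auto
  then have "summable (\<lambda>k. prob (A k))"
    by (rule summable_comparison_test'[where N = 0]) (use bound in auto)
  then have "AE \<omega> in M. \<forall>\<^sub>F k in sequentially. \<omega> \<in> space M - A k"
    using A_sets by (intro borel_cantelli_AE1) (auto simp: emeasure_eq_measure)
  then show ?thesis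
  proof eventually_elim
    case (elim \<omega>)
    then obtain k\<^sub>0 where k\<^sub>0: "\<And>k. k \<ge> k\<^sub>0 \<Longrightarrow> \<omega> \<in> space M - A k"
      by (auto simp: eventually_sequentially)
    have "{n \<in> L. norm (\<xi> n \<omega>) > \<eta> * norm n} \<subseteq> L \<inter> cball 0 (2 ^ k\<^sub>0)"
    proof (rule subsetI, rule ccontr)
      fix n assume n: "n \<in> {n \<in> L. norm (\<xi> n \<omega>) > \<eta> * norm n}" "n \<notin> L \<inter> cball 0 (2 ^ k\<^sub>0)"
      \<comment> \<open>The dyadic scale of \<open>n\<close>:
        \<open>2 ^ k \<le> norm n \<le> 2 ^ Suc k\<close>. For \<open>k = 0\<close> minimality says
        nothing, and the lower bound comes from
        \<open>norm n > 2 ^ k\<^sub>0 \<ge> 1\<close>.\<close>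
      define k where "k = (LEAST k. norm n \<le> 2 ^ Suc k)"
      obtain j where "norm n < 2 ^ j"
        using real_arch_pow[of 2 "norm n"] by auto
      then have "norm n \<le> 2 ^ Suc j"
        using norm_ge_zero[of n] unfolding power_Suc by linarith
      then have le: "norm n \<le> 2 ^ Suc k"
        unfolding k_def by (rule LeastI)
      have gt: "2 ^ k\<^sub>0 < norm n"
        using n by auto
      have "2 ^ k\<^sub>0 < (2 :: real) ^ Suc k"
        using gt le by linarith
      then have "k\<^sub>0 \<le> k"
        by (metis less_Suc_eq_le one_less_numeral_iff power_less_imp_less_exp semiring_norm(76))
      have "2 ^ k \<le> norm n"
      proof (cases k)
        case (Suc j)
        then have "\<not> norm n \<le> 2 ^ Suc j"
          unfolding k_def by (metis lessI not_less_Least)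
        then show ?thesis
          by (simp add: Suc)
      qed (use gt le_less_trans[of 1 "2 ^ k\<^sub>0" "norm n"] in simp)
      have "n \<in> L \<inter> cball 0 (2 ^ Suc k)"
        using n le by simp
      then have "\<not> norm (\<xi> n \<omega>) > \<eta> * 2 ^ k"
        using k\<^sub>0[OF \<open>k\<^sub>0 \<le> k\<close>] unfolding A_def by blast
      then have "norm (\<xi> n \<omega>) \<le> \<eta> * 2 ^ k"
        by simp
      also have "\<dots> \<le> \<eta> * norm n"
        using \<open>2 ^ k \<le> norm n\<close> assms by simp
      finally show False
        using n by simp
    qed
    then show ?case
      by (rule finite_subset) simp
  qed
qed

section \<open>Concentration of the centred character sums\<close>

definition char_term :: "'w \<Rightarrow> real ^ 'd \<Rightarrow> real ^ 'd \<Rightarrow> complex" where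
  "char_term \<omega> \<theta> n = cnj (e_fun ((n + \<xi> n \<omega>) \<bullet> \<theta>))"

text \<open>For \<open>n\<close> in \<open>L\<close> the subtracted term is the expectation of
  \<open>char_term\<close>, as \<open>expectation_char_term\<close> shows.\<close>

definition centred :: "'w \<Rightarrow> real ^ 'd \<Rightarrow> real ^ 'd \<Rightarrow> complex" where
  "centred \<omega> \<theta> n = char_term \<omega> \<theta> n - char_fun \<nu> \<theta> * cnj (e_fun (n \<bullet> \<theta>))"

lemma norm_char_term [simp]: "norm (char_term \<omega> \<theta> n) = 1"
  by (simp add: char_term_def)

lemma norm_centred_le: "norm (centred \<omega> \<theta> n) \<le> 2"
  unfolding centred_def
  using norm_triangle_ineq4[of "char_term \<omega> \<theta> n" "char_fun \<nu> \<theta> * cnj (e_fun (n \<bullet> \<theta>))"]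
    norm_char_fun_le[of \<theta>]
  by (simp add: norm_mult)

lemma char_term_measurable [measurable]:
  assumes [measurable]: "n \<in> L"
  shows "(\<lambda>\<omega>. char_term \<omega> \<theta> n) \<in> borel_measurable M"
  unfolding char_term_def
  by (rule measurable_compose[OF _ character_measurable]) measurable

lemma expectation_char_term:
  assumes "n \<in> L"
  shows "(LINT \<omega>|M. char_term \<omega> \<theta> n) = char_fun \<nu> \<theta> * cnj (e_fun (n \<bullet> \<theta>))"
proof -
  have "(LINT \<omega>|M. char_term \<omega> \<theta> n) = (LINT \<omega>|M. cnj (e_fun (n \<bullet> \<theta>)) * cnj (e_fun (\<xi> n \<omega> \<bullet> \<theta>)))"
    by (simp add: char_term_def inner_add_left e_fun_add)
  also have "\<dots> = cnj (e_fun (n \<bullet> \<theta>)) * (LINT \<omega>|M. cnj (e_fun (\<xi> n \<omega> \<bullet> \<theta>)))"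
    by simp
  also have "(LINT \<omega>|M. cnj (e_fun (\<xi> n \<omega> \<bullet> \<theta>))) = (LINT x|distr M borel (\<xi> n). cnj (e_fun (x \<bullet> \<theta>)))"
    using assms by (intro integral_distr[symmetric] character_measurable) simp
  finally show ?thesis
    by (simp add: ident assms char_fun_def mult.commute)
qed

text \<open>Hoeffding's inequality is about real variables, so \<open>h\<close> stands for
  \<open>Re\<close> or \<open>Im\<close>: it commutes with sums and expectations and maps the unit
  circle into an interval of length 2. With squared lengths adding up to \<open>4 * card F\<close>,
  the exponent \<open>2 * t\<^sup>2 / (4 * card F)\<close> is the one stated.\<close>

lemma Hoeffding_part:
  fixes h :: "complex \<Rightarrow> real"
  assumes h: "bounded_linear h" "\<And>z. \<bar>h z\<bar> \<le> norm z"
    and F: "finite F" "F \<subseteq> L" "F \<noteq> {}" and "t \<ge> 0"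
  shows "prob {\<omega> \<in> space M. \<bar>h (\<Sum>n\<in>F. centred \<omega> \<theta> n)\<bar> \<ge> t} \<le> 2 * exp (- (t\<^sup>2 / (2 * card F)))"
proof -
  interpret h: bounded_linear h by (rule h)
  have h_meas: "h \<in> borel_measurable borel"
    by (intro borel_measurable_continuous_onI h.continuous_on continuous_on_id)
  have ind: "indep_vars (\<lambda>_. borel) (\<lambda>n \<omega>. h (char_term \<omega> \<theta> n)) F"
  proof -
    have "indep_vars (\<lambda>_. borel) (\<lambda>n \<omega>. (\<lambda>x. h (cnj (e_fun ((n + x) \<bullet> \<theta>)))) (\<xi> n \<omega>)) F"
    proof (rule indep_vars_compose2[OF indep_vars_subset[OF indep F(2)]])
      show "(\<lambda>x. h (cnj (e_fun ((n + x) \<bullet> \<theta>)))) \<in> borel_measurable borel" for n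
        by (intro measurable_compose[OF _ h_meas] measurable_compose[OF _ character_measurable]) simp
    qed
    then show ?thesis
      by (simp add: char_term_def)
  qed
  interpret H: Hoeffding_ineq M F "\<lambda>n \<omega>. h (char_term \<omega> \<theta> n)" "\<lambda>_. -1" "\<lambda>_. 1"
    "\<Sum>n\<in>F. expectation (\<lambda>\<omega>. h (char_term \<omega> \<theta> n))"
  proof unfold_locales
    show "AE \<omega> in M. h (char_term \<omega> \<theta> n) \<in> {-1..1}" for n
      using h(2)[of "char_term _ \<theta> n"] by (auto simp: abs_le_iff minus_le_iff)
  qed (use F ind in auto)
  have "expectation (\<lambda>\<omega>. h (char_term \<omega> \<theta> n)) = h (char_fun \<nu> \<theta> * cnj (e_fun (n \<bullet> \<theta>)))" if "n \<in> F" for n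
  proof -
    have "integrable M (\<lambda>\<omega>. char_term \<omega> \<theta> n)"
      using that F by (intro integrable_const_bound[of _ 1]) auto
    moreover have "n \<in> L"
      using that F by auto
    ultimately show ?thesis
      by (simp add: integral_bounded_linear[OF h(1)] expectation_char_term)
  qed
  then have "h (\<Sum>n\<in>F. centred \<omega> \<theta> n)
      = (\<Sum>n\<in>F. h (char_term \<omega> \<theta> n)) - (\<Sum>n\<in>F. expectation (\<lambda>\<omega>. h (char_term \<omega> \<theta> n)))" for \<omega>
    by (simp add: centred_def h.sum h.diff sum_subtractf)
  moreover have "(\<Sum>n\<in>F. (1 - (-1 :: real))\<^sup>2) = 4 * card F"
    by simp
  moreover have "card F > 0"
    using F by (simp add: card_gt_0_iff)
  ultimately show ?thesis
    using H.Hoeffding_ineq_abs_ge[OF \<open>t \<ge> 0\<close>] by simp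
qed

lemma centred_measurable [measurable]: "n \<in> L \<Longrightarrow> (\<lambda>\<omega>. centred \<omega> \<theta> n) \<in> borel_measurable M"
  unfolding centred_def by measurable

text \<open>A complex number of norm at least \<open>2 * t\<close> has a real or an imaginary part
  of size at least \<open>t\<close>; the two tails add up to the factor 4.\<close>

lemma prob_norm_sum_centred_ge:
  assumes F: "finite F" "F \<subseteq> L" "F \<noteq> {}" and "t \<ge> 0"
  shows "prob {\<omega> \<in> space M. norm (\<Sum>n\<in>F. centred \<omega> \<theta> n) \<ge> 2 * t} \<le> 4 * exp (- (t\<^sup>2 / (2 * card F)))"
proof -
  let ?S = "\<lambda>\<omega>. \<Sum>n\<in>F. centred \<omega> \<theta> n"
  let ?A = "\<lambda>h. {\<omega> \<in> space M. \<bar>h (?S \<omega>)\<bar> \<ge> t}"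
  have [measurable]: "?S \<in> borel_measurable M"
    using F by (intro borel_measurable_sum) auto
  have "{\<omega> \<in> space M. norm (?S \<omega>) \<ge> 2 * t} \<subseteq> ?A Re \<union> ?A Im"
  proof
    fix \<omega> assume "\<omega> \<in> {\<omega> \<in> space M. norm (?S \<omega>) \<ge> 2 * t}"
    then show "\<omega> \<in> ?A Re \<union> ?A Im"
      using cmod_le[of "?S \<omega>"] by auto
  qed
  moreover have [measurable]: "?A Re \<in> events" "?A Im \<in> events"
    by measurable
  ultimately have "prob {\<omega> \<in> space M. norm (?S \<omega>) \<ge> 2 * t} \<le> prob (?A Re \<union> ?A Im)"
    by (intro finite_measure_mono) auto
  also have "\<dots> \<le> prob (?A Re) + prob (?A Im)"
    by (rule measure_Un_le) fact+
  also have "\<dots> \<le> 4 * exp (- (t\<^sup>2 / (2 * card F)))"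
    using Hoeffding_part[OF bounded_linear_Re abs_Re_le_cmod assms, of \<theta>]
      Hoeffding_part[OF bounded_linear_Im abs_Im_le_cmod assms, of \<theta>] by linarith
  finally show ?thesis .
qed

text \<open>Every \<open>\<theta>\<close> is eventually within \<open>O(1/k\<^sup>2)\<close> of the grid, which beats the Lipschitz constant
  \<open>O(k)\<close> in \<open>\<theta>\<close> of the averages over the ball of radius \<open>k\<close>; the grid has only \<open>O(k\<^sup>3\<^sup>d)\<close> points.\<close>

definition grid :: "nat \<Rightarrow> (real ^ 'd) set" where
  "grid k = (\<lambda>n. n /\<^sub>R real k ^ 2) ` (L \<inter> cball 0 (real k ^ 3))"

text \<open>With \<open>t = \<delta> * N k\<close> the Hoeffding exponent is
  \<open>\<delta>\<^sup>2 / 2 * N k\<close>, at least linear in \<open>k\<close>, while the grid has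
  at most \<open>N (k ^ 3)\<close> points. The union bound is therefore summable over
  \<open>k\<close>.\<close>

lemma AE_grid_bound:
  assumes "\<delta> > 0"
  shows "AE \<omega> in M. \<forall>\<^sub>F k in sequentially. \<forall>\<theta>\<in>grid k.
    norm (\<Sum>n\<in>L \<inter> cball 0 (real k). centred \<omega> \<theta> n) < 2 * (\<delta> * N (real k))"
proof -
  let ?S = "\<lambda>k \<omega> \<theta>. \<Sum>n\<in>L \<inter> cball 0 (real k). centred \<omega> \<theta> n"
  let ?d = "CARD('d)"
  obtain C c where C: "C > 0" "\<And>R. R \<ge> 1 \<Longrightarrow> N R \<le> C * R ^ ?d"
    and c: "c > 0" "\<forall>\<^sub>F R in at_top. c * R \<le> N R"
    using N_bounds by metis
  define A where "A k = (\<Union>\<theta>\<in>grid k. {\<omega> \<in> space M. norm (?S k \<omega> \<theta>) \<ge> 2 * (\<delta> * N (real k))})" for k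
  have fin: "finite (grid k)" for k
    by (simp add: grid_def)
  have S_meas [measurable]: "(\<lambda>\<omega>. ?S k \<omega> \<theta>) \<in> borel_measurable M" for k \<theta>
    by (intro borel_measurable_sum) auto
  have A_sets: "A k \<in> events" for k
    unfolding A_def using fin by (intro sets.finite_UN) auto
  have bound: "prob (A k) \<le> 4 * C * (real k ^ (3 * ?d) * exp (- (\<delta>\<^sup>2 * c / 2 * real k)))"
    if k: "k \<ge> 1" "c * real k \<le> N (real k)" for k
  proof -
    have "N (real k) > 0"
      using k c(1) by (smt (verit, best) mult_pos_pos of_nat_0_less_iff less_le_trans zero_less_one)
    then have ne: "L \<inter> cball 0 (real k) \<noteq> {}"
      by (auto simp: N_def)
    have "prob {\<omega> \<in> space M. norm (?S k \<omega> \<theta>) \<ge> 2 * (\<delta> * N (real k))}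
        \<le> 4 * exp (- (\<delta>\<^sup>2 * c / 2 * real k))" for \<theta>
    proof -
      have "prob {\<omega> \<in> space M. norm (?S k \<omega> \<theta>) \<ge> 2 * (\<delta> * N (real k))}
          \<le> 4 * exp (- ((\<delta> * N (real k))\<^sup>2 / (2 * N (real k))))"
        using prob_norm_sum_centred_ge[of "L \<inter> cball 0 (real k)" "\<delta> * N (real k)" \<theta>] assms ne
        by (simp add: N_def)
      also have "(\<delta> * N (real k))\<^sup>2 / (2 * N (real k)) = \<delta>\<^sup>2 / 2 * N (real k)"
        using \<open>N (real k) > 0\<close> by (simp add: power2_eq_square)
      also have "4 * exp (- (\<delta>\<^sup>2 / 2 * N (real k))) \<le> 4 * exp (- (\<delta>\<^sup>2 / 2 * (c * real k)))"
        using k by (simp add: mult_left_mono)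
      finally show ?thesis
        by (simp add: mult.assoc)
    qed
    note * = this
    have "prob (A k) \<le> (\<Sum>\<theta>\<in>grid k. prob {\<omega> \<in> space M. norm (?S k \<omega> \<theta>) \<ge> 2 * (\<delta> * N (real k))})"
      unfolding A_def using fin by (intro finite_measure_subadditive_finite) auto
    also have "\<dots> \<le> (\<Sum>\<theta>\<in>grid k. 4 * exp (- (\<delta>\<^sup>2 * c / 2 * real k)))"
      by (intro sum_mono *)
    also have "\<dots> = card (grid k) * (4 * exp (- (\<delta>\<^sup>2 * c / 2 * real k)))"
      by simp
    also have "real (card (grid k)) \<le> N (real k ^ 3)"
      unfolding grid_def N_def by (simp add: card_image_le)
    also have "N (real k ^ 3) \<le> C * real k ^ (3 * ?d)"
      using C(2)[of "real k ^ 3"] k by (simp add: power_mult)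
    finally show ?thesis
      by (simp add: mult_ac mult_right_mono)
  qed
  have "summable (\<lambda>k. 4 * C * (real k ^ (3 * ?d) * exp (- (\<delta>\<^sup>2 * c / 2 * real k))))"
    using assms c by (intro summable_mult summable_power_times_exp_minus) simp
  moreover have "\<forall>\<^sub>F k in sequentially. norm (prob (A k))
      \<le> 4 * C * (real k ^ (3 * ?d) * exp (- (\<delta>\<^sup>2 * c / 2 * real k)))"
    using eventually_ge_at_top[of 1] c(2)[THEN eventually_compose_filterlim, OF filterlim_real_sequentially]
  proof eventually_elim
    case (elim k)
    then show ?case
      using bound[of k] by (simp only: real_norm_def abs_of_nonneg measure_nonneg)
  qed
  ultimately have "summable (\<lambda>k. prob (A k))"
    by (rule summable_comparison_test_ev[rotated])
  then have "AE \<omega> in M. \<forall>\<^sub>F k in sequentially. \<omega> \<in> space M - A k"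
    using A_sets by (intro borel_cantelli_AE1) (auto simp: emeasure_eq_measure)
  then show ?thesis
    by eventually_elim (auto elim!: eventually_mono simp: A_def not_le)
qed

text \<open>Take a lattice point within \<rho> of \<open>k\<^sup>2 *\<^sub>R \<theta>\<close> and
  scale back. Its norm is at most \<open>k\<^sup>2 * (norm \<theta> + \<rho>)\<close>, hence at most
  \<open>k ^ 3\<close> once \<open>k\<close> exceeds \<open>norm \<theta> + \<rho>\<close>; \<rho>
  itself does not depend on \<theta>.\<close>

lemma grid_approximates:
  obtains \<rho> where "\<And>\<theta>. \<forall>\<^sub>F k in sequentially. \<exists>\<theta>'\<in>grid k. norm (\<theta> - \<theta>') \<le> \<rho> / real k ^ 2"
proof -
  obtain \<rho> where \<rho>: "\<rho> > 0" "\<And>x. \<exists>n\<in>L. norm (x - n) \<le> \<rho>"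
    using covering_radius by blast
  have "\<forall>\<^sub>F k in sequentially. \<exists>\<theta>'\<in>grid k. norm (\<theta> - \<theta>') \<le> \<rho> / real k ^ 2" for \<theta>
    using eventually_ge_at_top[of 1] eventually_ge_at_top[of "nat \<lceil>norm \<theta> + \<rho>\<rceil>"]
  proof eventually_elim
    case (elim k)
    let ?s = "real k ^ 2"
    have s: "?s \<ge> 1"
      using elim by (intro one_le_power) simp
    obtain n where n: "n \<in> L" "norm (?s *\<^sub>R \<theta> - n) \<le> \<rho>"
      using \<rho>(2) by blast
    have "norm n \<le> norm (?s *\<^sub>R \<theta>) + norm (?s *\<^sub>R \<theta> - n)"
      using norm_triangle_ineq4[of "?s *\<^sub>R \<theta>" "?s *\<^sub>R \<theta> - n"] by simp
    also have "\<dots> \<le> ?s * norm \<theta> + ?s * \<rho>"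
    proof (rule add_mono)
      have "1 * \<rho> \<le> ?s * \<rho>"
        using s \<rho>(1) by (intro mult_right_mono) auto
      then show "norm (?s *\<^sub>R \<theta> - n) \<le> ?s * \<rho>"
        using n(2) by linarith
    qed simp
    also have "\<dots> = ?s * (norm \<theta> + \<rho>)"
      by (simp add: distrib_left)
    also have "\<dots> \<le> ?s * real k"
      using elim s by (intro mult_left_mono) linarith+
    finally have "n \<in> L \<inter> cball 0 (real k ^ 3)"
      using n by (simp add: power2_eq_square power3_eq_cube)
    then have "n /\<^sub>R ?s \<in> grid k"
      unfolding grid_def by (rule imageI)
    moreover have "norm (\<theta> - n /\<^sub>R ?s) \<le> \<rho> / ?s"
    proof -
      have "?s \<noteq> 0"
        using s by linarith
      then have "\<theta> - n /\<^sub>R ?s = (?s *\<^sub>R \<theta> - n) /\<^sub>R ?s"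
        by (simp add: scaleR_diff_right)
      then have "norm (\<theta> - n /\<^sub>R ?s) = norm (?s *\<^sub>R \<theta> - n) / ?s"
        by (simp only: norm_scaleR) (simp add: divide_inverse mult.commute)
      then show ?thesis
        using n s by (simp add: divide_right_mono)
    qed
    ultimately show ?case
      by blast
  qed
  then show thesis
    using that by blast
qed

text \<open>A Lipschitz bound for each outcome: the perturbed character contributes
  \<open>norm n + norm (\<xi> n \<omega>)\<close>, and the product rule for the subtracted mean adds
  \<open>norm n\<close> and the first moment.\<close>

lemma norm_centred_diff_le:
  "norm (centred \<omega> \<theta> n - centred \<omega> \<theta>' n)
    \<le> 2 * pi * (norm (\<xi> n \<omega>) + 2 * norm n + (LINT x|\<nu>. norm x)) * norm (\<theta> - \<theta>')"
proof -
  let ?e = "\<lambda>\<theta> x. cnj (e_fun (x \<bullet> \<theta>))" and ?E = "LINT x|\<nu>. norm x"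
  let ?t = "norm (\<theta> - \<theta>')"
  have "centred \<omega> \<theta> n - centred \<omega> \<theta>' n = (?e \<theta> (n + \<xi> n \<omega>) - ?e \<theta>' (n + \<xi> n \<omega>))
      - ((char_fun \<nu> \<theta> - char_fun \<nu> \<theta>') * ?e \<theta> n + char_fun \<nu> \<theta>' * (?e \<theta> n - ?e \<theta>' n))"
    by (simp add: centred_def char_term_def algebra_simps)
  also have "norm \<dots> \<le> norm (?e \<theta> (n + \<xi> n \<omega>) - ?e \<theta>' (n + \<xi> n \<omega>))
      + (norm ((char_fun \<nu> \<theta> - char_fun \<nu> \<theta>') * ?e \<theta> n) + norm (char_fun \<nu> \<theta>' * (?e \<theta> n - ?e \<theta>' n)))"
    by (intro order_trans[OF norm_triangle_ineq4] add_left_mono norm_triangle_ineq)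
  also have "\<dots> \<le> 2 * pi * (norm n + norm (\<xi> n \<omega>)) * ?t + (2 * pi * ?E * ?t + 2 * pi * norm n * ?t)"
  proof (intro add_mono)
    show "norm (?e \<theta> (n + \<xi> n \<omega>) - ?e \<theta>' (n + \<xi> n \<omega>)) \<le> 2 * pi * (norm n + norm (\<xi> n \<omega>)) * ?t"
      by (rule order_trans[OF norm_character_diff_le])
        (intro mult_right_mono mult_left_mono norm_triangle_ineq; simp)
    show "norm ((char_fun \<nu> \<theta> - char_fun \<nu> \<theta>') * ?e \<theta> n) \<le> 2 * pi * ?E * ?t"
      using norm_char_fun_diff_le[of \<theta> \<theta>'] by (simp add: norm_mult)
    have "norm (char_fun \<nu> \<theta>' * (?e \<theta> n - ?e \<theta>' n)) \<le> 1 * norm (?e \<theta> n - ?e \<theta>' n)"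
      unfolding norm_mult by (intro mult_right_mono norm_char_fun_le) simp
    then show "norm (char_fun \<nu> \<theta>' * (?e \<theta> n - ?e \<theta>' n)) \<le> 2 * pi * norm n * ?t"
      using norm_character_diff_le[of n \<theta> \<theta>'] by linarith
  qed
  also have "\<dots> = 2 * pi * (norm (\<xi> n \<omega>) + 2 * norm n + ?E) * ?t"
    by (simp add: algebra_simps)
  finally show ?thesis .
qed

text \<open>The thresholds \<open>1 / Suc j\<close> are countable, so one almost sure event controls
  all grids; off the grid, \<theta> is replaced by a nearby grid point.\<close>

lemma AE_tendsto_centred_sequence:
  "AE \<omega> in M. \<forall>\<theta>. (\<lambda>k. norm (\<Sum>n\<in>L \<inter> cball 0 (real k). centred \<omega> \<theta> n) / N (real k)) \<longlonglongrightarrow> 0"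
proof -
  let ?S = "\<lambda>\<omega> \<theta> k. \<Sum>n\<in>L \<inter> cball 0 (real k). centred \<omega> \<theta> n"
  obtain c where c: "c > 0" "\<forall>\<^sub>F R in at_top. c * R \<le> N R"
    using N_bounds by metis
  obtain \<rho> where \<rho>: "\<And>\<theta>. \<forall>\<^sub>F k in sequentially. \<exists>\<theta>'\<in>grid k. norm (\<theta> - \<theta>') \<le> \<rho> / real k ^ 2"
    using grid_approximates by blast
  define E where "E = (LINT x|\<nu>. norm x)"
  have "AE \<omega> in M. \<forall>j. \<forall>\<^sub>F k in sequentially. \<forall>\<theta>\<in>grid k.
      norm (?S \<omega> \<theta> k) < 2 * (1 / real (Suc j) * N (real k))"
    unfolding AE_all_countable by (intro allI AE_grid_bound) simp
  moreover have "AE \<omega> in M. finite {n \<in> L. norm (\<xi> n \<omega>) > 1 * norm n}"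
    by (rule AE_finite_large_perturbations) simp
  ultimately show ?thesis
  proof eventually_elim
    case (elim \<omega>)
    \<comment> \<open>Only finitely many perturbations exceed \<open>norm n\<close>; the sum of
      their norms dominates each of them and turns the bound into one valid for all
      \<open>n\<close>, with \<open>K\<close> depending on the outcome.\<close>
    define K where "K = (\<Sum>n | n \<in> L \<and> norm (\<xi> n \<omega>) > 1 * norm n. norm (\<xi> n \<omega>))"
    have "K \<ge> 0"
      unfolding K_def by (rule sum_nonneg) simp
    have xi_le: "norm (\<xi> n \<omega>) \<le> norm n + K" if "n \<in> L" for n
    proof (cases "norm (\<xi> n \<omega>) > 1 * norm n")
      case True
      then have "norm (\<xi> n \<omega>) \<le> K"
        unfolding K_def using elim(2) that by (intro member_le_sum) auto
      then show ?thesis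
        by (simp add: add_increasing)
    qed (use \<open>K \<ge> 0\<close> in simp)
    show ?case
    proof (intro allI LIMSEQ_I)
      fix \<theta> and r :: real assume "r > 0"
      \<comment> \<open>Half of \<open>r\<close> is reserved for the fluctuation at the grid point,
        the other half for the move from \<theta> to it.\<close>
      obtain j where j: "4 / r < real (Suc j)"
        using reals_Archimedean2[of "4 / r"] by (metis less_trans lessI of_nat_less_iff)
      then have j': "2 / real (Suc j) < r / 2"
        using \<open>r > 0\<close> by (simp add: field_simps)
      \<comment> \<open>For \<open>norm n \<le> k\<close> the Lipschitz constant is at most
        \<open>2 * pi * (3 * k + K + E)\<close>: once \<open>k\<close> from the perturbation, twice
        from \<open>2 * norm n\<close>.\<close>
      have "(\<lambda>k. 2 * pi * (3 * real k + K + E) * (\<rho> / real k ^ 2)) \<longlonglongrightarrow> 0"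
        by real_asymp
      then have "\<forall>\<^sub>F k in sequentially. 2 * pi * (3 * real k + K + E) * (\<rho> / real k ^ 2) < r / 2"
        using \<open>r > 0\<close> by (intro order_tendstoD) auto
      moreover note \<rho>[of \<theta>] elim(1)[rule_format, of j] eventually_gt_at_top[of 0]
        c(2)[THEN eventually_compose_filterlim, OF filterlim_real_sequentially]
      ultimately have "\<forall>\<^sub>F k in sequentially. norm (norm (?S \<omega> \<theta> k) / N (real k) - 0) < r"
      proof eventually_elim
        case (elim k)
        have "N (real k) > 0"
          using elim c(1) by (smt (verit) mult_pos_pos of_nat_0_less_iff)
        obtain \<theta>' where \<theta>': "\<theta>' \<in> grid k" "norm (\<theta> - \<theta>') \<le> \<rho> / real k ^ 2"
          using elim by blast
        have "norm (?S \<omega> \<theta> k - ?S \<omega> \<theta>' k) \<le> (\<Sum>n\<in>L \<inter> cball 0 (real k). 2 * pi * (3 * real k + K + E) * (\<rho> / real k ^ 2))"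
          unfolding sum_subtractf[symmetric]
        proof (rule sum_norm_le)
          fix n assume n: "n \<in> L \<inter> cball 0 (real k)"
          have "0 \<le> E"
            unfolding E_def by (rule Bochner_Integration.integral_nonneg) simp
          then have "2 * pi * (norm (\<xi> n \<omega>) + 2 * norm n + E) * norm (\<theta> - \<theta>')
              \<le> 2 * pi * (3 * real k + K + E) * (\<rho> / real k ^ 2)"
            using n xi_le[of n] \<open>K \<ge> 0\<close> by (intro mult_mono \<theta>'(2)) auto
          then show "norm (centred \<omega> \<theta> n - centred \<omega> \<theta>' n) \<le> 2 * pi * (3 * real k + K + E) * (\<rho> / real k ^ 2)"
            using norm_centred_diff_le[of \<omega> \<theta> n \<theta>'] unfolding E_def by linarith
        qed
        also have "\<dots> = N (real k) * (2 * pi * (3 * real k + K + E) * (\<rho> / real k ^ 2))"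
          by (simp add: N_def)
        also have "\<dots> \<le> N (real k) * (r / 2)"
          using elim(1) by (intro mult_left_mono) auto
        finally have "norm (?S \<omega> \<theta> k) \<le> N (real k) * (r / 2) + norm (?S \<omega> \<theta>' k)"
          using norm_triangle_sub[of "?S \<omega> \<theta> k" "?S \<omega> \<theta>' k"] by linarith
        also have "norm (?S \<omega> \<theta>' k) < 2 * (1 / real (Suc j) * N (real k))"
          using elim(3) \<theta>'(1) by blast
        also have "2 * (1 / real (Suc j) * N (real k)) = 2 / real (Suc j) * N (real k)"
          by simp
        also have "\<dots> \<le> r / 2 * N (real k)"
          using j' by (intro mult_right_mono) auto
        finally have "norm (?S \<omega> \<theta> k) < r * N (real k)"
          by (simp add: mult.commute)
        then show ?case
          using \<open>N (real k) > 0\<close> by (simp add: divide_less_eq)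
      qed
      then show "\<exists>no. \<forall>k\<ge>no. norm (norm (?S \<omega> \<theta> k) / N (real k) - 0) < r"
        by (simp add: eventually_sequentially)
    qed
  qed
qed

text \<open>Passage from integer to real radii: replacing \<open>R\<close> by its floor changes the
  sum only in a shell of bounded width, whose share of the volume vanishes.\<close>

lemma tendsto_centred_sum:
  assumes "(\<lambda>k. norm (\<Sum>n\<in>L \<inter> cball 0 (real k). centred \<omega> \<theta> n) / N (real k)) \<longlonglongrightarrow> 0"
  shows "((\<lambda>R. (\<Sum>n\<in>L \<inter> cball 0 R. centred \<omega> \<theta> n) / vol R) \<longlongrightarrow> 0) at_top"
proof (rule Lim_null_comparison)
  let ?S = "\<lambda>R. \<Sum>n\<in>L \<inter> cball 0 R. centred \<omega> \<theta> n"
  let ?k = "\<lambda>R :: real. nat \<lfloor>R\<rfloor>"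
  let ?q = "\<lambda>R. norm (?S (real (?k R))) / N (real (?k R))"
  have "filterlim ?k sequentially (at_top :: real filter)"
    by (intro filterlim_compose[OF filterlim_nat_sequentially] filterlim_floor_sequentially filterlim_ident)
  then have q: "(?q \<longlongrightarrow> 0) at_top"
    using filterlim_compose[OF assms, of ?k at_top] by simp
  show "((\<lambda>R. 4 * ((N (R + 1) - N (R - 1)) / vol R) + ?q R * (N (1 * R + 0) / vol R)) \<longlongrightarrow> 0) at_top"
    using tendsto_add[OF tendsto_mult[OF tendsto_const[of 4] tendsto_N_shell[of 1]]
        tendsto_mult[OF q tendsto_N_ratio[of 1 0]]] by simp
  show "\<forall>\<^sub>F R in at_top. norm (?S R / vol R)
      \<le> 4 * ((N (R + 1) - N (R - 1)) / vol R) + ?q R * (N (1 * R + 0) / vol R)"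
    using eventually_gt_at_top[of 0]
  proof eventually_elim
    case (elim R)
    have k: "real (?k R) \<le> R" "R - 1 \<le> real (?k R)"
      using elim by linarith+
    have "norm (?S R - ?S (real (?k R))) \<le> 2 * 2 * (real (card (L \<inter> cball 0 (R + 1))) - real (card (L \<inter> cball 0 (R - 1))))"
    proof (rule norm_sum_diff_le_card)
      show "L \<inter> cball 0 (R - 1) \<subseteq> L \<inter> cball 0 (real (?k R))" "L \<inter> cball 0 (real (?k R)) \<subseteq> L \<inter> cball 0 (R + 1)"
        using k by (intro Int_mono subset_cball subset_refl; linarith)+
    qed (auto intro: norm_centred_le)
    moreover have "norm (?S (real (?k R))) \<le> ?q R * N R"
    proof (cases "N (real (?k R)) = 0")
      case True
      then have "L \<inter> cball 0 (real (?k R)) = {}"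
        by (simp add: N_def)
      then show ?thesis
        by simp
    next
      case False
      then have "norm (?S (real (?k R))) = ?q R * N (real (?k R))"
        by simp
      also have "\<dots> \<le> ?q R * N R"
        using k by (intro mult_left_mono N_mono) auto
      finally show ?thesis .
    qed
    ultimately have "norm (?S R) \<le> 4 * (N (R + 1) - N (R - 1)) + ?q R * N R"
      using norm_triangle_sub[of "?S R" "?S (real (?k R))"] by (simp add: N_def)
    then have "norm (?S R) / vol R \<le> (4 * (N (R + 1) - N (R - 1)) + ?q R * N R) / vol R"
      by (rule divide_right_mono) simp
    then show ?case
      by (simp add: norm_divide add_divide_distrib)
  qed
qed

lemma tendsto_char_term_sum:
  assumes "(\<lambda>k. norm (\<Sum>n\<in>L \<inter> cball 0 (real k). centred \<omega> \<theta> n) / N (real k)) \<longlonglongrightarrow> 0"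
  shows "((\<lambda>R. (\<Sum>n\<in>L \<inter> cball 0 R. char_term \<omega> \<theta> n) / vol R)
    \<longlongrightarrow> (if \<theta> \<in> dual_lattice L then char_fun \<nu> \<theta> else 0)) at_top"
proof -
  have "((\<lambda>R. (\<Sum>n\<in>L \<inter> cball 0 R. centred \<omega> \<theta> n) / vol R
        + char_fun \<nu> \<theta> * ((\<Sum>n\<in>L \<inter> cball 0 R. cnj (e_fun (n \<bullet> \<theta>))) / vol R))
      \<longlongrightarrow> 0 + char_fun \<nu> \<theta> * (if \<theta> \<in> dual_lattice L then 1 else 0)) at_top"
    by (intro tendsto_intros tendsto_centred_sum[OF assms] tendsto_character_sum)
  moreover have "(\<Sum>n\<in>L \<inter> cball 0 R. centred \<omega> \<theta> n) / vol R
        + char_fun \<nu> \<theta> * ((\<Sum>n\<in>L \<inter> cball 0 R. cnj (e_fun (n \<bullet> \<theta>))) / vol R)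
      = (\<Sum>n\<in>L \<inter> cball 0 R. char_term \<omega> \<theta> n) / vol R" for R
    by (simp add: centred_def sum_subtractf sum_distrib_left diff_divide_distrib)
  ultimately show ?thesis
    by (simp split: if_splits)
qed

section \<open>Perturbed points in the ball against lattice points in the ball\<close>

lemma exp_mean_eq:
  assumes "finite {n \<in> L. n + \<xi> n \<omega> \<in> cball 0 R}"
  shows "exp_mean L \<xi> \<omega> R \<theta> = (\<Sum>n | n \<in> L \<and> n + \<xi> n \<omega> \<in> cball 0 R. char_term \<omega> \<theta> n) / vol R"
  using assms unfolding exp_mean_def points_in_ball_def char_term_def vol_def
  by (simp add: image_mset.compositionality comp_def sum_unfold_sum_mset)

text \<open>Outside \<open>F\<close> the triangle inequality places
  \<open>norm (n + \<xi> n \<omega>)\<close> between \<open>(1 - \<eta>) * norm n\<close> and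
  \<open>(1 + \<eta>) * norm n\<close>.\<close>

lemma perturbed_ball_bounds:
  assumes "0 < \<eta>" "\<eta> < 1" and F: "F = {n \<in> L. norm (\<xi> n \<omega>) > \<eta> * norm n}"
  shows "L \<inter> cball 0 (R / (1 + \<eta>)) - F \<subseteq> {n \<in> L. n + \<xi> n \<omega> \<in> cball 0 R}"
    and "{n \<in> L. n + \<xi> n \<omega> \<in> cball 0 R} \<subseteq> L \<inter> cball 0 (R / (1 - \<eta>)) \<union> F"
proof -
  show "L \<inter> cball 0 (R / (1 + \<eta>)) - F \<subseteq> {n \<in> L. n + \<xi> n \<omega> \<in> cball 0 R}"
  proof
    fix n assume "n \<in> L \<inter> cball 0 (R / (1 + \<eta>)) - F"
    then have "n \<in> L" "norm n * (1 + \<eta>) \<le> R" "norm (\<xi> n \<omega>) \<le> \<eta> * norm n"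
      using assms by (auto simp: F pos_le_divide_eq)
    then show "n \<in> {n \<in> L. n + \<xi> n \<omega> \<in> cball 0 R}"
      using norm_triangle_ineq[of n "\<xi> n \<omega>"] by (simp add: algebra_simps)
  qed
  show "{n \<in> L. n + \<xi> n \<omega> \<in> cball 0 R} \<subseteq> L \<inter> cball 0 (R / (1 - \<eta>)) \<union> F"
  proof (rule subsetI, rule UnCI)
    fix n assume n: "n \<in> {n \<in> L. n + \<xi> n \<omega> \<in> cball 0 R}" "n \<notin> F"
    then have "norm (n + \<xi> n \<omega>) \<le> R" "norm (\<xi> n \<omega>) \<le> \<eta> * norm n"
      by (auto simp: F)
    then have "norm n * (1 - \<eta>) \<le> R"
      using norm_triangle_ineq4[of "n + \<xi> n \<omega>" "\<xi> n \<omega>"] by (simp add: algebra_simps)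
    then show "n \<in> L \<inter> cball 0 (R / (1 - \<eta>))"
      using n assms by (simp add: pos_le_divide_eq)
  qed
qed

text \<open>Both index sets lie between lattice balls of radii \<open>b j * R\<close> and
  \<open>a j * R\<close>, up to the finite set \<open>B j\<close>. For fixed \<open>j\<close> the
  normalised difference is asymptotically at most \<open>2 * (a j ^ d - b j ^ d)\<close>, which is
  small for large \<open>j\<close>. The offset in \<open>j + 2\<close> keeps the ratio below
  1.\<close>

lemma tendsto_exp_mean:
  assumes fin: "\<And>j. finite {n \<in> L. norm (\<xi> n \<omega>) > 1 / real (j + 2) * norm n}"
    and lim: "((\<lambda>R. (\<Sum>n\<in>L \<inter> cball 0 R. char_term \<omega> \<theta> n) / vol R) \<longlongrightarrow> l) at_top"
  shows "((\<lambda>R. exp_mean L \<xi> \<omega> R \<theta>) \<longlongrightarrow> l) at_top"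
proof -
  let ?d = "CARD('d)"
  let ?S = "\<lambda>A. \<Sum>n\<in>A. char_term \<omega> \<theta> n"
  define P where "P R = {n \<in> L. n + \<xi> n \<omega> \<in> cball 0 R}" for R
  define B where "B j = {n \<in> L. norm (\<xi> n \<omega>) > 1 / real (j + 2) * norm n}" for j
  define a where "a j = 1 / (1 - 1 / real (j + 2))" for j
  define b where "b j = 1 / (1 + 1 / real (j + 2))" for j
  have pos: "a j > 0" "b j > 0" for j
    by (simp_all add: a_def b_def add_pos_pos)
  have sub: "L \<inter> cball 0 (b j * R) - B j \<subseteq> P R" "P R \<subseteq> L \<inter> cball 0 (a j * R) \<union> B j" for j R
    using perturbed_ball_bounds[of "1 / real (j + 2)" "B j" \<omega> R]
    by (simp_all add: P_def B_def a_def b_def)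
  have fin_P: "finite (P R)" for R
    using sub(2)[of R 0] fin[of 0] by (auto intro: finite_subset simp: B_def)
  have bound: "norm (?S (P R) / vol R - ?S (L \<inter> cball 0 R) / vol R)
      \<le> 2 * (N (a j * R + 0) / vol R - N (b j * R + 0) / vol R + 2 * card (B j) / vol R)"
    if "R > 0" for R j
  proof -
    \<comment> \<open>\<open>B j\<close> is added to the outer set and removed from the inner one,
      so it is counted twice in the bound.\<close>
    let ?U = "L \<inter> cball 0 (a j * R) \<union> B j" and ?C = "L \<inter> cball 0 (b j * R) - B j"
    have ab: "b j * R \<le> R" "R \<le> a j * R"
      using that by (simp_all add: a_def b_def field_simps)
    have "norm (?S (P R) - ?S (L \<inter> cball 0 R)) \<le> 2 * 1 * (real (card ?U) - real (card ?C))"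
    proof (rule norm_sum_diff_le_card)
      show "finite ?U"
        using fin[of j] by (simp add: B_def)
      show "?C \<subseteq> L \<inter> cball 0 R" "L \<inter> cball 0 R \<subseteq> ?U"
        using ab by auto
    qed (use sub in auto)
    moreover have "real (card ?U) \<le> N (a j * R) + card (B j)"
      using card_Un_le[of "L \<inter> cball 0 (a j * R)" "B j"] by (simp add: N_def)
    moreover have "N (b j * R) \<le> real (card ?C) + card (B j)"
      using diff_card_le_card_Diff[of "B j" "L \<inter> cball 0 (b j * R)"] fin[of j] by (simp add: N_def B_def)
    ultimately have "norm (?S (P R) - ?S (L \<inter> cball 0 R)) \<le> 2 * (N (a j * R) - N (b j * R) + 2 * card (B j))"
      by simp
    then have "norm (?S (P R) - ?S (L \<inter> cball 0 R)) / vol R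
        \<le> 2 * (N (a j * R) - N (b j * R) + 2 * card (B j)) / vol R"
      by (rule divide_right_mono) simp
    then show ?thesis
      by (simp add: norm_divide add_divide_distrib diff_divide_distrib flip: diff_divide_distrib)
  qed
  have "((\<lambda>R. ?S (P R) / vol R - ?S (L \<inter> cball 0 R) / vol R) \<longlongrightarrow> 0) at_top"
  proof (rule tendstoI)
    fix r :: real assume "r > 0"
    \<comment> \<open>The order matters: \<open>j\<close> is fixed by \<open>r\<close> first, and
      only then does \<open>R\<close> grow, so that the finite set \<open>B j\<close> becomes
      negligible.\<close>
    have "a \<longlonglongrightarrow> 1" "b \<longlonglongrightarrow> 1"
      unfolding a_def b_def by real_asymp+
    then have "(\<lambda>j. 2 * (a j ^ ?d - b j ^ ?d + 0)) \<longlonglongrightarrow> 2 * (1 ^ ?d - 1 ^ ?d + 0)"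
      by (intro tendsto_intros)
    then have "\<forall>\<^sub>F j in sequentially. 2 * (a j ^ ?d - b j ^ ?d + 0) < r"
      using \<open>r > 0\<close> by (intro order_tendstoD) auto
    then obtain j where j: "2 * (a j ^ ?d - b j ^ ?d + 0) < r"
      by (auto simp: eventually_sequentially)
    have "((\<lambda>R. 2 * card (B j) / vol R) \<longlongrightarrow> 0) at_top"
    proof -
      have "filterlim vol at_top at_top"
      proof (rule filterlim_at_top_mono)
        show "filterlim (\<lambda>R. unit_ball_vol ?d * R ^ ?d) at_top at_top"
          by (intro filterlim_tendsto_pos_mult_at_top[OF tendsto_const] filterlim_pow_at_top filterlim_ident) auto
        show "\<forall>\<^sub>F R in at_top. unit_ball_vol ?d * R ^ ?d \<le> vol R"
          using eventually_ge_at_top[of 0]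
          by eventually_elim (simp add: vol_def measure_lebesgue_cball del: measure_completion)
      qed
      then show ?thesis
        by (intro tendsto_divide_0[OF tendsto_const] filterlim_at_top_imp_at_infinity)
    qed
    then have "((\<lambda>R. 2 * (N (a j * R + 0) / vol R - N (b j * R + 0) / vol R + 2 * card (B j) / vol R))
        \<longlongrightarrow> 2 * (a j ^ ?d - b j ^ ?d + 0)) at_top"
      by (intro tendsto_intros tendsto_N_ratio pos)
    then have "\<forall>\<^sub>F R in at_top. 2 * (N (a j * R + 0) / vol R - N (b j * R + 0) / vol R + 2 * card (B j) / vol R) < r"
      using j by (rule order_tendstoD)
    then show "\<forall>\<^sub>F R in at_top. dist (?S (P R) / vol R - ?S (L \<inter> cball 0 R) / vol R) 0 < r"
      using eventually_gt_at_top[of 0]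
    proof eventually_elim
      case (elim R)
      then show ?case
        unfolding dist_norm diff_zero using bound[of R j] by (rule_tac le_less_trans)
    qed
  qed
  from tendsto_add[OF this lim] have "((\<lambda>R. ?S (P R) / vol R) \<longlongrightarrow> l) at_top"
    by simp
  then show ?thesis
    using exp_mean_eq[OF fin_P[unfolded P_def]] by (simp add: P_def)
qed

end

text \<open>Both parts converge to real numbers, so the default value for infinite upper limits does
  not arise.\<close>

lemma complex_limsup_eq:
  assumes "(f \<longlongrightarrow> l) at_top"
  shows "complex_limsup f = l"
proof -
  have "Limsup at_top (\<lambda>R. ereal (Re (f R))) = ereal (Re l)"
    "Limsup at_top (\<lambda>R. ereal (Im (f R))) = ereal (Im l)"
    using assms by (auto intro!: lim_imp_Limsup tendsto_Re tendsto_Im)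
  then show ?thesis
    by (simp add: complex_limsup_def)
qed

text \<open>The quantifier over \<theta> stands inside the almost sure statement, as needed to
  identify the whole set of frequencies; nonvanishing of \<open>char_fun \<nu>\<close> then turns
  the values into that set.\<close>

theorem (in perturbed_lattice) AE_T_fun:
  "AE \<omega> in M. \<forall>\<theta>. T_fun L \<xi> \<omega> \<theta> = (if \<theta> \<in> dual_lattice L then char_fun \<nu> \<theta> else 0)"
proof -
  have "AE \<omega> in M. \<forall>j. finite {n \<in> L. norm (\<xi> n \<omega>) > 1 / real (j + 2) * norm n}"
    unfolding AE_all_countable by (intro allI AE_finite_large_perturbations) simp
  with AE_tendsto_centred_sequence show ?thesis
    by eventually_elim
      (simp add: T_fun_def complex_limsup_eq[OF tendsto_exp_mean[OF _ tendsto_char_term_sum]])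
qed

theorem mainTheorem2:
  fixes L D :: "(real ^ 'd) set"
    and M :: "'w measure"
    and \<xi> :: "real ^ 'd \<Rightarrow> 'w \<Rightarrow> real ^ 'd"
    and \<nu> :: "(real ^ 'd) measure"
    and \<epsilon> :: real
  assumes lattice: "full_lattice L"
    and domain: "fundamental_domain L D" "measure lebesgue D = 1"
    and prob: "prob_space M"
    and indep: "prob_space.indep_vars M (\<lambda>_. borel) \<xi> L"
    and ident: "\<And>n. n \<in> L \<Longrightarrow> distr M borel (\<xi> n) = \<nu>"
    and moment: "\<epsilon> > 0" "integrable \<nu> (\<lambda>x. norm x powr (real CARD('d) + \<epsilon>))"
    and nonvanishing: "\<And>\<theta>. char_fun \<nu> \<theta> \<noteq> 0"
  shows "AE \<omega> in M. {\<theta>. T_fun L \<xi> \<omega> \<theta> \<noteq> 0} = dual_lattice L"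
proof -
  interpret prob_space M
    by (rule prob)
  interpret perturbed_lattice L D M \<xi> \<nu> \<epsilon>
    by unfold_locales (use assms in auto)
  show ?thesis
    using AE_T_fun by eventually_elim (use nonvanishing in auto)
qed

end
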